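(* Let $(a_{i,j})_{i,j\ge 1}$ be real numbers such that $a_{i,j}=a_{j,i}\ge 0$ for all $i,j\ge 1$, and suppose there are $\gamma\in[0,1]$ and $A_\gamma>0$ with $a_{i,j}\le A_\gamma (ij)^\gamma$ for all $i,j\ge 1$. Let $b_{i,j;k}\ge 0$ ($1\le i\le j-1$, $j\ge 2$, $k\ge 1$) satisfy $$\sum_{i=1}^{j-1} i\, b_{i,j;k}=j,\qquad j\ge 2,\ k\ge 1,$$ and suppose there are constants $\beta_0,\beta_1\ge 0$ such that $$b_{s,i;j}\le \beta_0+\beta_1 b_{s,j;i},\qquad 1\le s\le i-1,\ j\ge i.$$ Given $w^{\rm in}\in Y_{1+\gamma}^+$, there is a unique solution $w$ on $[0,+\infty)$ to the discrete collision-induced breakage equation with initial condition $w^{\rm in}$ satisfying $$\sup_{t\in[0,T]}\sum_{i=1}^\infty i^{1+\gamma}w_i(t)<\infty\qquad\text{for each } T\in(0,+\infty).$$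
   Context: Function spaces. For $\gamma_0\ge 0$, $Y_{\gamma_0}$ is the Banach space of real sequences $y=(y_i)_{i\ge1}$ with $\|y\|_{\gamma_0}:=\sum_{i\ge 1} i^{\gamma_0}|y_i|<\infty$, and $Y_{\gamma_0}^+:=\{y\in Y_{\gamma_0}: y_i\ge 0 \text{ for all } i\ge 1\}$. Equation. The discrete collision-induced breakage equation is $$\frac{dw_i}{dt}=\sum_{j=i+1}^{\infty}\sum_{k=1}^{\infty} a_{j,k}\, b_{i,j;k}\, w_j w_k-\sum_{j=1}^{\infty}a_{i,j}w_iw_j,\qquad w_i(0)=w_i^{\rm in},\qquad i\ge 1.$$ Solution. Let $T\in(0,+\infty]$ and $w^{\rm in}\in Y_1^+$. A solution on $[0,T)$ is a sequence $w=(w_i)_{i\ge 1}$ of non-negative continuous functions such that for each $i\ge 1$ and $t\in(0,T)$: (1) $w_i\in \mathcal C([0,T))$, $\sum_{j=1}^\infty a_{i,j}w_j\in L^1(0,t)$, and $\sum_{j=i+1}^\infty\sum_{k=1}^\infty b_{i,j;k}a_{j,k}w_jw_k\in L^1(0,t)$; (2) $$w_i(t)=w_i^{\rm in}+\int_0^t\Big(\sum_{j=i+1}^{\infty}\sum_{k=1}^{\infty} b_{i,j;k}a_{j,k}w_j(\tau)w_k(\tau)-\sum_{j=1}^{\infty}a_{i,j}w_i(\tau)w_j(\tau)\Big)d\tau .$$ *)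

theory Defs
  imports "HOL-Analysis.Analysis"
begin

text \<open>
  Sequences indexed by \<open>i \<ge> 1\<close> are functions on \<^typ>\<open>nat\<close> whose value at \<open>0\<close> is irrelevant.
  The coefficients are \<open>a i j\<close> for $a_{i,j}$ and \<open>b i j k\<close> for $b_{i,j;k}$.
\<close>

definition Y :: "real \<Rightarrow> (nat \<Rightarrow> real) set" where
  "Y g = {y. (\<lambda>i. real i powr g * \<bar>y i\<bar>) summable_on {1..}}"

definition Y_pos :: "real \<Rightarrow> (nat \<Rightarrow> real) set" where
  "Y_pos g = {y \<in> Y g. \<forall>i\<ge>1. 0 \<le> y i}"

definition gain :: "(nat \<Rightarrow> nat \<Rightarrow> real) \<Rightarrow> (nat \<Rightarrow> nat \<Rightarrow> nat \<Rightarrow> real) \<Rightarrow> (nat \<Rightarrow> real) \<Rightarrow> nat \<Rightarrow> real"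
  where "gain a b y i = (\<Sum>\<^sub>\<infinity>j\<in>{i+1..}. \<Sum>\<^sub>\<infinity>k\<in>{1..}. b i j k * a j k * y j * y k)"

text \<open>
  \<^const>\<open>infsum\<close> is \<open>0\<close> on divergent families, so convergence has to be stated separately.
\<close>

definition gain_converges ::
    "(nat \<Rightarrow> nat \<Rightarrow> real) \<Rightarrow> (nat \<Rightarrow> nat \<Rightarrow> nat \<Rightarrow> real) \<Rightarrow> (nat \<Rightarrow> real) \<Rightarrow> nat \<Rightarrow> bool"
  where "gain_converges a b y i \<longleftrightarrow>
    (\<forall>j\<ge>i+1. (\<lambda>k. b i j k * a j k * y j * y k) summable_on {1..}) \<and>
    (\<lambda>j. \<Sum>\<^sub>\<infinity>k\<in>{1..}. b i j k * a j k * y j * y k) summable_on {i+1..}"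

text \<open>
  \<open>w i t\<close> is $w_i(t)$, and only its values for \<open>i \<ge> 1\<close> and \<open>t \<in> [0, T)\<close> matter.
  That a series of non-negative functions belongs to $L^1(0,t)$ means that it converges almost
  everywhere on \<open>(0, t)\<close> and that its sum is integrable there.
\<close>

definition is_solution ::
    "(nat \<Rightarrow> nat \<Rightarrow> real) \<Rightarrow> (nat \<Rightarrow> nat \<Rightarrow> nat \<Rightarrow> real) \<Rightarrow> ereal \<Rightarrow> (nat \<Rightarrow> real) \<Rightarrow>
     (nat \<Rightarrow> real \<Rightarrow> real) \<Rightarrow> bool"
  where "is_solution a b T w_in w \<longleftrightarrow>
    0 < T \<and> w_in \<in> Y_pos 1 \<and>
    (\<forall>i\<ge>1.
      (\<forall>t. 0 \<le> t \<and> ereal t < T \<longrightarrow> 0 \<le> w i t) \<and>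
      continuous_on {t. 0 \<le> t \<and> ereal t < T} (w i) \<and>
      (\<forall>t. 0 < t \<and> ereal t < T \<longrightarrow>
        (AE \<tau> in lebesgue. \<tau> \<in> {0<..<t} \<longrightarrow> (\<lambda>j. a i j * w j \<tau>) summable_on {1..}) \<and>
        set_integrable lebesgue {0<..<t} (\<lambda>\<tau>. \<Sum>\<^sub>\<infinity>j\<in>{1..}. a i j * w j \<tau>) \<and>
        (AE \<tau> in lebesgue. \<tau> \<in> {0<..<t} \<longrightarrow> gain_converges a b (\<lambda>l. w l \<tau>) i) \<and>
        set_integrable lebesgue {0<..<t} (\<lambda>\<tau>. gain a b (\<lambda>l. w l \<tau>) i) \<and>
        w i t = w_in i + (LINT \<tau>:{0<..<t}|lebesgue.
          gain a b (\<lambda>l. w l \<tau>) i - (\<Sum>\<^sub>\<infinity>j\<in>{1..}. a i j * w i \<tau> * w j \<tau>))))"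

definition moment_locally_bounded :: "real \<Rightarrow> (nat \<Rightarrow> real \<Rightarrow> real) \<Rightarrow> bool" where
  "moment_locally_bounded p w \<longleftrightarrow>
    (\<forall>T>0. (\<forall>t\<in>{0..T}. (\<lambda>i. real i powr p * w i t) summable_on {1..}) \<and>
           bdd_above ((\<lambda>t. \<Sum>\<^sub>\<infinity>i\<in>{1..}. real i powr p * w i t) ` {0..T}))"

end

theory Submission
  imports Defs
begin

text \<open>
  Let $u = w - v$ be the difference of two solutions. Writing
  $w_j w_k - v_j v_k = \frac12 (u_j (w_k + v_k) + u_k (w_j + v_j))$, mass conservation in a collision
  makes the contribution of the first summand to the derivative of $\sum_i i |u_i|$ nonpositive, and the
  second contributes at most $C \sum_i i |u_i|$ with $C$ controlled by the moments of order $1 + \gamma$.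
  Gronwall's argument then gives continuous dependence on the initial data in the norm of $Y_1$,
  hence uniqueness.

  Existence follows from the same estimate. If $w_i^{in} = 0$ for $i > N$, the equation is a finite
  system of ordinary differential equations, whose solutions have nonincreasing moments and tails
  because collisions only produce smaller clusters. By stability the solutions for the truncated
  initial data form a Cauchy sequence in $Y_1$, locally uniformly in time, and the uniform control of
  the tails of order $1 + \gamma$ allows one to pass to the limit in the equation.
\<close>

subsection \<open>Set integrals over real intervals\<close>

text \<open>The obstacle is a mismatch of weights. As \<gamma> \<le> 1,
  \<open>real j * a j k\<close> is at most \<open>A * (real j powr (1 + \<gamma>) * real k)\<close>,
  so a weighted collision term costs one moment of order 1 + \<gamma> and one of order 1. The part
  with u_k costs only the Y_1 norm of u, but the part with u_j would cost the moment of order 1 +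
  \<gamma> of u, which Y_1 does not control: it must cancel, not be estimated. The cancellation,
  between the fragments produced and the cluster lost, is incomplete in a sum over i \<le> n,
  because a cluster of size j > n contributes fragments while its loss is not counted. The error is
  a tail of the moment of order 1 + \<gamma>; it vanishes as n grows, by dominated convergence in
  time. The limit in the equation meets the same gap: the operator is estimated by the moment of
  order 1 + \<gamma>, while stability gives convergence in Y_1. Tails that are small uniformly in
  the truncation close it. The finite system is quadratic, hence only locally Lipschitz. Cutting
  every factor off at the initial mass makes it globally Lipschitz, and mass decay, valid for the
  cut system too, shows that the cutoff never acts.\<close>

text \<open>
  A chain rule for \<open>\<bar>u\<bar>\<close> that avoids differentiating \<open>u\<close>: the sign of \<open>u\<close> is replaced by its values
  at the right endpoints of finer and finer partitions. At a zero of \<open>u\<close> these values need not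
  converge, which is why the hypothesis asks for every \<open>\<sigma>\<close> in $[-1, 1]$ there.
\<close>

lemma abs_le_set_integral_of_sign_bound:
  fixes u f h :: "real \<Rightarrow> real"
  assumes t: "0 < t" and cont: "continuous_on {0..t} u"
    and f: "set_integrable lebesgue {0<..<t} f"
    and h: "set_integrable lebesgue {0<..<t} h"
    and u: "\<And>r. 0 \<le> r \<Longrightarrow> r \<le> t \<Longrightarrow> u r = u 0 + (LINT s:{0<..<r}|lebesgue. f s)"
    and bound: "\<And>s \<sigma>. 0 < s \<Longrightarrow> s < t \<Longrightarrow> \<bar>\<sigma>\<bar> \<le> 1 \<Longrightarrow> \<sigma> * u s = \<bar>u s\<bar> \<Longrightarrow> \<sigma> * f s \<le> h s"
  shows "\<bar>u t\<bar> \<le> \<bar>u 0\<bar> + (LINT s:{0<..<t}|lebesgue. h s)"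
proof -
  define r where "r n k = t * real k / real (Suc n)" for n k
  \<comment> \<open>A difference of two consecutive indicators is the indicator of the half-open
    cell [\<open>r n k\<close>, \<open>r n (Suc k)\<close>), so at every point of (0, t)
    \<open>\<phi> n\<close> is exactly \<open>f\<close> times the sign of \<open>u\<close> at the
    right end of the cell.\<close>
  define \<phi> where "\<phi> n s = (\<Sum>k<Suc n. sgn (u (r n (Suc k))) *
      (indicator {0<..<r n (Suc k)} s * f s - indicator {0<..<r n k} s * f s))" for n s
  define h1 where "h1 s = indicator {0<..<t} s * h s" for s
  define f1 where "f1 s = indicator {0<..<t} s * f s" for s
  have h1: "integrable lebesgue h1"
    using h unfolding h1_def set_integrable_def by simp
  have f1: "integrable lebesgue f1"
    using f unfolding f1_def set_integrable_def by simp
  have r_bounds: "0 \<le> r n k" "k \<le> Suc n \<Longrightarrow> r n k \<le> t" "r n k \<le> r n (Suc k)" for n k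
  proof -
    show "0 \<le> r n k" "r n k \<le> r n (Suc k)"
      using t by (auto simp: r_def intro!: divide_right_mono mult_left_mono)
    assume "k \<le> Suc n"
    then have "t * real k \<le> t * real (Suc n)"
      using t by (intro mult_left_mono) linarith+
    then show "r n k \<le> t" by (simp add: r_def divide_le_eq del: of_nat_Suc)
  qed
  have r_ends: "r n 0 = 0" "r n (Suc n) = t" for n
    by (auto simp: r_def)
  have int_piece: "integrable lebesgue (\<lambda>s. indicator {0<..<r n k} s * f s)" if "k \<le> Suc n" for n k
  proof -
    have "set_integrable lebesgue {0<..<r n k} f"
      by (rule set_integrable_subset[OF f]) (use r_bounds(2)[OF that] in auto)
    then show ?thesis by (simp add: set_integrable_def)
  qed
  have u': "u (r n k) = u 0 + (LINT s|lebesgue. indicator {0<..<r n k} s * f s)" if "k \<le> Suc n" for n k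
    using u[OF r_bounds(1) r_bounds(2)[OF that]] by (simp add: set_lebesgue_integral_def)
  have int_\<phi>: "integrable lebesgue (\<phi> n)" for n
    unfolding \<phi>_def by (intro Bochner_Integration.integrable_sum integrable_mult_right
        Bochner_Integration.integrable_diff int_piece) auto
  have lower: "\<bar>u t\<bar> - \<bar>u 0\<bar> \<le> (LINT s|lebesgue. \<phi> n s)" for n
  proof -
    have "\<bar>u t\<bar> - \<bar>u 0\<bar> = (\<Sum>k<Suc n. \<bar>u (r n (Suc k))\<bar> - \<bar>u (r n k)\<bar>)"
      using sum_lessThan_telescope[of "\<lambda>k. \<bar>u (r n k)\<bar>" "Suc n"] by (simp only: r_ends)
    \<comment> \<open>Here the right endpoint matters: |x| - |y| \<le> sgn x * (x - y), whereas with
      sgn y the inequality is reversed.\<close>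
    also have "\<dots> \<le> (\<Sum>k<Suc n. sgn (u (r n (Suc k))) * (u (r n (Suc k)) - u (r n k)))"
      by (intro sum_mono) (auto simp: sgn_if abs_if)
    also have "\<dots> = (\<Sum>k<Suc n. sgn (u (r n (Suc k))) *
       (LINT s|lebesgue. indicator {0<..<r n (Suc k)} s * f s - indicator {0<..<r n k} s * f s))"
      by (intro sum.cong refl, subst Bochner_Integration.integral_diff)
         (auto simp: u' intro!: int_piece)
    also have "\<dots> = (LINT s|lebesgue. \<phi> n s)"
      unfolding \<phi>_def by (subst Bochner_Integration.integral_sum)
        (auto intro!: int_piece Bochner_Integration.integrable_diff)
    finally show ?thesis .
  qed
  have cell: "\<exists>k<Suc n. r n k \<le> s \<and> s < r n (Suc k) \<and> \<phi> n s = sgn (u (r n (Suc k))) * f s"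
    if s: "0 < s" "s < t" for n s
  proof -
    define k where "k = nat \<lfloor>s * real (Suc n) / t\<rfloor>"
    have k0: "0 \<le> \<lfloor>s * real (Suc n) / t\<rfloor>" using s t by simp
    have k1: "real k \<le> s * real (Suc n) / t" "s * real (Suc n) / t < real k + 1"
      unfolding k_def using k0 by linarith+
    have ks: "r n k \<le> s" "s < r n (Suc k)"
      using k1 t by (auto simp: r_def field_simps)
    have "k < Suc n"
    proof (rule ccontr)
      assume "\<not> k < Suc n"
      then have "t * real (Suc n) \<le> t * real k"
        using t by (intro mult_left_mono) linarith+
      then have "t \<le> r n k" by (simp add: r_def le_divide_eq del: of_nat_Suc)
      with ks s show False by simp
    qed
    have mono: "r n i \<le> r n j" if "i \<le> j" for i j
      using that t by (auto simp: r_def intro!: divide_right_mono mult_left_mono)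
    have ind: "indicator {0<..<r n (Suc j)} s * f s - indicator {0<..<r n j} s * f s
        = (if j = k then f s else 0)" for j
    proof -
      consider "j < k" | "j = k" | "j > k" by linarith
      then show ?thesis
      proof cases
        case 1 then show ?thesis using ks mono[of "Suc j" k] mono[of j k] s by (auto simp: indicator_def)
      next
        case 2 then show ?thesis using ks s by (auto simp: indicator_def)
      next
        case 3 then show ?thesis using ks mono[of "Suc k" j] mono[of "Suc k" "Suc j"] s by (auto simp: indicator_def)
      qed
    qed
    have "\<phi> n s = sgn (u (r n (Suc k))) * f s"
      unfolding \<phi>_def ind using \<open>k < Suc n\<close> by (simp add: if_distrib sum.delta cong: if_cong)
    with ks \<open>k < Suc n\<close> show ?thesis by blast
  qed
  have \<phi>_out: "\<phi> n s = 0" if "\<not> (0 < s \<and> s < t)" for n s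
  proof -
    have "indicator {0<..<r n k} s = (0::real)" if "k \<le> Suc n" for k
      using r_bounds(2)[OF that] \<open>\<not> (0 < s \<and> s < t)\<close> by (auto simp: indicator_def)
    then show ?thesis unfolding \<phi>_def by (intro sum.neutral) auto
  qed
  have \<phi>_le: "\<bar>\<phi> n s\<bar> \<le> \<bar>f1 s\<bar>" for n s
  proof (cases "0 < s \<and> s < t")
    case True
    then obtain k where "\<phi> n s = sgn (u (r n (Suc k))) * f s" using cell by blast
    then have "\<bar>\<phi> n s\<bar> \<le> \<bar>f s\<bar>" by (auto simp: abs_mult sgn_if)
    with True show ?thesis by (simp add: f1_def)
  qed (simp add: \<phi>_out)
  \<comment> \<open>Where \<open>u\<close> vanishes, \<open>\<phi> n s\<close> may oscillate with
    \<open>n\<close> and is only known to stay below \<open>h s\<close>. The maximum with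
    \<open>h1\<close> is eventually constant at every point, so dominated convergence applies to
    it.\<close>
  have ev: "\<forall>\<^sub>F n in sequentially. max (\<phi> n s) (h1 s) = h1 s" for s
  proof (cases "0 < s \<and> s < t")
    case False
    then show ?thesis by (simp add: \<phi>_out h1_def)
  next
    case s: True
    show ?thesis
    proof (cases "u s = 0")
      case True
      have "max (\<phi> n s) (h1 s) = h1 s" for n
      proof -
        obtain k where k: "\<phi> n s = sgn (u (r n (Suc k))) * f s" using s cell by blast
        have "sgn (u (r n (Suc k))) * f s \<le> h s"
          by (rule bound) (use s True in \<open>auto simp: sgn_if\<close>)
        then show ?thesis using k s by (simp add: h1_def)
      qed
      then show ?thesis by simp
    next
      case False
      have "\<exists>d>0. \<forall>x\<in>{0..t}. dist x s < d \<longrightarrow> dist (u x) (u s) < \<bar>u s\<bar>"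
        using cont[unfolded continuous_on_iff] s False by auto
      then obtain d where d: "d > 0" "\<And>x. x \<in> {0..t} \<Longrightarrow> dist x s < d \<Longrightarrow> dist (u x) (u s) < \<bar>u s\<bar>"
        by blast
      obtain N where N: "t / d < real N" using reals_Archimedean2 by blast
      have "max (\<phi> n s) (h1 s) = h1 s" if n: "n \<ge> N" for n
      proof -
        obtain k where k: "k < Suc n" "r n k \<le> s" "s < r n (Suc k)"
            "\<phi> n s = sgn (u (r n (Suc k))) * f s" using s cell by blast
        have "r n (Suc k) - r n k = t / real (Suc n)"
          by (simp add: r_def algebra_simps flip: diff_divide_distrib del: of_nat_Suc)
            (simp add: algebra_simps)
        also have "\<dots> < d" using N n d(1) t
          by (simp add: divide_less_eq field_simps) (smt (verit) mult_left_mono of_nat_mono)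
        finally have "dist (r n (Suc k)) s < d" using k by (auto simp: dist_real_def)
        then have "dist (u (r n (Suc k))) (u s) < \<bar>u s\<bar>"
          using d(2)[of "r n (Suc k)"] r_bounds(1,2)[of n "Suc k"] r_bounds(2)[of "Suc k" n] k by auto
        then have "sgn (u (r n (Suc k))) = sgn (u s)"
          by (auto simp: dist_real_def sgn_if)
        then have "\<phi> n s = sgn (u s) * f s" using k by simp
        also have "\<dots> \<le> h s" by (rule bound) (use s in \<open>auto simp: sgn_if\<close>)
        finally show ?thesis using s by (simp add: h1_def)
      qed
      then show ?thesis unfolding eventually_sequentially by blast
    qed
  qed
  have "(\<lambda>n. LINT s|lebesgue. max (\<phi> n s) (h1 s)) \<longlonglongrightarrow> (LINT s|lebesgue. h1 s)"
  proof (rule integral_dominated_convergence[where w = "\<lambda>s. \<bar>f1 s\<bar> + \<bar>h1 s\<bar>"])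
    show "AE s in lebesgue. (\<lambda>n. max (\<phi> n s) (h1 s)) \<longlonglongrightarrow> h1 s"
      using ev by (intro AE_I2 tendsto_eventually) 
    show "AE s in lebesgue. norm (max (\<phi> n s) (h1 s)) \<le> \<bar>f1 s\<bar> + \<bar>h1 s\<bar>" for n
      using \<phi>_le[of n] by (intro AE_I2) (smt (verit) real_norm_def)
    show "(\<lambda>s. max (\<phi> n s) (h1 s)) \<in> borel_measurable lebesgue" for n
      using int_\<phi>[of n] h1 by measurable
  qed (use f1 h1 in auto)
  moreover have "\<bar>u t\<bar> - \<bar>u 0\<bar> \<le> (LINT s|lebesgue. max (\<phi> n s) (h1 s))" for n
    using lower[of n] integral_mono[OF int_\<phi>[of n] integrable_max[OF int_\<phi>[of n] h1]] by force
  ultimately have "\<bar>u t\<bar> - \<bar>u 0\<bar> \<le> (LINT s|lebesgue. h1 s)"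
    by (intro LIMSEQ_le_const[where X = "\<lambda>n. LINT s|lebesgue. max (\<phi> n s) (h1 s)"]) auto
  then show ?thesis unfolding h1_def set_lebesgue_integral_def by simp
qed

section \<open>Measurability and integrability in the time variable\<close>

lemma borel_measurable_infsum:
  fixes f :: "'i::countable \<Rightarrow> 'a \<Rightarrow> real"
  assumes meas: "\<And>i. i \<in> I \<Longrightarrow> f i \<in> borel_measurable M"
    and summable: "\<And>x. x \<in> space M \<Longrightarrow> (\<lambda>i. f i x) summable_on I"
  shows "(\<lambda>x. \<Sum>\<^sub>\<infinity>i\<in>I. f i x) \<in> borel_measurable M"
proof (cases "finite I")
  case True
  then show ?thesis using meas by simp
next
  case False
  then have bij: "bij_betw (from_nat_into I) UNIV I"
    by (rule bij_betw_from_nat_into[OF countableI_type])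
  have mem: "from_nat_into I n \<in> I" for n
    using bij by (auto simp: bij_betw_def)
  have "(\<Sum>\<^sub>\<infinity>i\<in>I. f i x) = (\<Sum>n. f (from_nat_into I n) x)" if "x \<in> space M" for x
  proof -
    have "(\<lambda>n. f (from_nat_into I n) x) summable_on UNIV"
      using summable_on_reindex_bij_betw[OF bij, of "\<lambda>i. f i x"] summable[OF that] by simp
    then have "(\<Sum>\<^sub>\<infinity>n. f (from_nat_into I n) x) = (\<Sum>n. f (from_nat_into I n) x)"
      by (intro sums_unique has_sum_imp_sums has_sum_infsum)
    then show ?thesis using infsum_reindex_bij_betw[OF bij, of "\<lambda>i. f i x"] by simp
  qed
  moreover have "(\<lambda>x. \<Sum>n. f (from_nat_into I n) x) \<in> borel_measurable M"
    using meas[OF mem] by measurable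
  ultimately show ?thesis by (subst measurable_cong) auto
qed

lemma set_integral_FTC_Ioo:
  fixes F f :: "real \<Rightarrow> real"
  assumes "0 \<le> t" and F: "\<And>s. s \<in> {0..t} \<Longrightarrow> (F has_real_derivative f s) (at s within {0..t})"
    and cont: "continuous_on {0..t} f"
  shows "set_integrable lebesgue {0<..<t} f" "(LINT s:{0<..<t}|lebesgue. f s) = F t - F 0"
proof -
  have "set_integrable lebesgue {0..t} f"
    using absolutely_integrable_continuous_real[OF cont] .
  then show int: "set_integrable lebesgue {0<..<t} f"
    by (rule set_integrable_subset) auto
  have "(f has_integral F t - F 0) {0..t}"
    by (rule fundamental_theorem_of_calculus)
       (use assms in \<open>auto simp: has_real_derivative_iff_has_vector_derivative\<close>)
  then have "integral {0<..<t} f = F t - F 0"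
    by (metis integral_open_interval_real integral_unique)
  then show "(LINT s:{0<..<t}|lebesgue. f s) = F t - F 0"
    using set_lebesgue_integral_eq_integral(2)[OF int] by simp
qed

lemma
  fixes f :: "'i \<Rightarrow> 'a \<Rightarrow> real"
  assumes "finite I" and f: "\<And>i. i \<in> I \<Longrightarrow> set_integrable M A (f i)"
  shows set_integrable_sum: "set_integrable M A (\<lambda>x. \<Sum>i\<in>I. f i x)"
    and set_integral_sum: "(LINT x:A|M. \<Sum>i\<in>I. f i x) = (\<Sum>i\<in>I. LINT x:A|M. f i x)"
  using f unfolding set_integrable_def set_lebesgue_integral_def
  by (simp_all add: scaleR_sum_right del: real_scaleR_def)

lemma abs_set_integral_le:
  fixes f g :: "'a \<Rightarrow> real"
  assumes f: "set_integrable M A f" and g: "set_integrable M A g" and le: "\<And>x. \<bar>f x\<bar> \<le> g x"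
  shows "\<bar>LINT x:A|M. f x\<bar> \<le> (LINT x:A|M. g x)"
proof -
  have "\<bar>LINT x:A|M. f x\<bar> \<le> (LINT x|M. \<bar>indicator A x *\<^sub>R f x\<bar>)"
    unfolding set_lebesgue_integral_def by (rule integral_abs_bound)
  also have "\<dots> \<le> (LINT x:A|M. g x)"
    unfolding set_lebesgue_integral_def
  proof (rule integral_mono)
    show "\<bar>indicator A x *\<^sub>R f x\<bar> \<le> indicator A x *\<^sub>R g x" for x
      using le[of x] by (simp split: split_indicator)
  qed (use f g in \<open>auto simp: set_integrable_def simp del: real_scaleR_def\<close>)
  finally show ?thesis .
qed

lemma set_integrable_bounded_Ioo:
  fixes f :: "real \<Rightarrow> real"
  assumes "f \<in> borel_measurable lebesgue" "\<And>s. s \<in> {0<..<t} \<Longrightarrow> \<bar>f s\<bar> \<le> B"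
  shows "set_integrable lebesgue {0<..<t} f"
proof (rule set_integrable_bound)
  show "set_integrable lebesgue {0<..<t} (\<lambda>_. B)"
    unfolding set_integrable_def by (cases "0 \<le> t") (auto intro!: integrable_real_indicator)
  show "set_borel_measurable lebesgue {0<..<t} f"
    using assms(1) unfolding set_borel_measurable_def
    by (intro borel_measurable_scaleR borel_measurable_indicator) auto
  show "AE x in lebesgue. x \<in> {0<..<t} \<longrightarrow> norm (f x) \<le> norm B"
    using assms(2) by (intro AE_I2) fastforce
qed

lemma borel_measurable_lebesgue_continuous:
  fixes f :: "real \<Rightarrow> real"
  assumes "continuous_on UNIV f"
  shows "f \<in> borel_measurable lebesgue"
  using borel_measurable_continuous_onI[OF assms] by (simp add: measurable_completion)

subsection \<open>Global solutions of Lipschitz equations in Banach spaces\<close>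

lemma bcontfun_dist_le_iff:
  fixes x y :: "'a::topological_space \<Rightarrow>\<^sub>C 'b::metric_space"
  shows "dist x y \<le> d \<longleftrightarrow> (\<forall>i. dist (apply_bcontfun x i) (apply_bcontfun y i) \<le> d)"
  using dist_bound dist_bounded order_trans by blast

lemma has_integral_exp_mult:
  fixes \<kappa> t :: real assumes "0 < \<kappa>" "0 \<le> t"
  shows "((\<lambda>s. exp (\<kappa> * s)) has_integral (exp (\<kappa> * t) - 1) / \<kappa>) {0..t}"
proof -
  have "((\<lambda>s. exp (\<kappa> * s)) has_integral exp (\<kappa> * t) / \<kappa> - exp (\<kappa> * 0) / \<kappa>) {0..t}"
    by (rule fundamental_theorem_of_calculus)
       (use assms in \<open>auto intro!: derivative_eq_intros simp flip: has_real_derivative_iff_has_vector_derivative\<close>)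
  then show ?thesis by (simp add: diff_divide_distrib)
qed

text \<open>
  The Picard operator is a contraction with factor $1/2$ in the norm
  $\sup_t e^{-\kappa t} \|x(t)\|$ with $\kappa = 2L$, so no continuation argument is needed.
\<close>

lemma ex_global_solution_lipschitz:
  fixes f :: "'a::banach \<Rightarrow> 'a"
  assumes L: "0 < L" and lip: "\<And>x y. norm (f x - f y) \<le> L * norm (x - y)"
  shows "\<exists>x. x 0 = x0 \<and> (\<forall>t\<ge>0. (x has_vector_derivative f (x t)) (at t within {0..}))"
proof -
  define \<kappa> where "\<kappa> = 2 * L"
  have \<kappa>: "0 < \<kappa>" using L by (simp add: \<kappa>_def)
  have cont_f: "continuous_on UNIV f"
    by (rule lipschitz_on_continuous_on[where L=L])
       (use L lip in \<open>auto simp: lipschitz_on_def dist_norm\<close>)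
  \<comment> \<open>The unknown is y(t) = exp (- \<kappa> t) x(t): the weighted norm of x is then
    the sup norm of y, and bounded continuous functions on the whole line serve as the Banach space.
    In \<open>\<Phi>\<close>, \<open>max 0 t\<close> extends the path to negative times by its value
    at 0.\<close>
  define g where "g y s = f (exp (\<kappa> * s) *\<^sub>R y s)" for y :: "real \<Rightarrow> 'a" and s
  define \<Phi> where "\<Phi> y t = exp (- \<kappa> * max 0 t) *\<^sub>R (x0 + integral {0..max 0 t} (g y))" for y t
  have cont_g: "continuous_on S (g y)" if "continuous_on UNIV y" for y S
    unfolding g_def
    by (rule continuous_on_compose2[OF cont_f])
       (use continuous_on_subset[OF that] in \<open>auto intro!: continuous_intros\<close>)
  have norm_g: "norm (g y s) \<le> norm (f 0) + L * B * exp (\<kappa> * s)" if "\<And>s. norm (y s) \<le> B" for y s B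
  proof -
    have "norm (g y s) \<le> norm (f 0) + norm (f (exp (\<kappa> * s) *\<^sub>R y s) - f 0)"
      unfolding g_def by (metis norm_triangle_sub)
    also have "\<dots> \<le> norm (f 0) + L * (exp (\<kappa> * s) * B)"
      using lip[of "exp (\<kappa> * s) *\<^sub>R y s" 0] L that[of s]
      by (smt (verit) diff_zero exp_gt_zero mult_left_mono norm_scaleR real_norm_def abs_of_pos)
    finally show ?thesis by (simp add: mult_ac)
  qed
  have norm_diff: "norm (g y s - g z s) \<le> L * B * exp (\<kappa> * s)" if "\<And>s. norm (y s - z s) \<le> B" for y z s B
  proof -
    have "norm (g y s - g z s) \<le> L * norm (exp (\<kappa> * s) *\<^sub>R (y s - z s))"
      unfolding g_def using lip by (simp add: scaleR_diff_right)
    also have "\<dots> \<le> L * (exp (\<kappa> * s) * B)"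
      using L that[of s] by (intro mult_left_mono) auto
    finally show ?thesis by (simp add: mult_ac)
  qed
  have cont_\<Phi>: "continuous_on UNIV (\<Phi> y)" if y: "continuous_on UNIV y" for y
  proof -
    have "continuous_on {0..} (\<lambda>t. integral {0..t} (g y))"
    proof (rule continuous_on_eq_continuous_within[THEN iffD2], intro ballI)
      fix t :: real assume "t \<in> {0..}"
      have "continuous_on {0..t+1} (\<lambda>t. integral {0..t} (g y))"
        by (intro indefinite_integral_continuous_1 integrable_continuous_real cont_g y)
      then have "continuous (at t within {0..t+1}) (\<lambda>t. integral {0..t} (g y))"
        using \<open>t \<in> {0..}\<close> by (auto simp: continuous_on_eq_continuous_within)
      moreover have "at t within {0..t+1} = at t within {0..}"
        by (rule at_within_nhd[where S="{..<t+1}"]) auto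
      ultimately show "continuous (at t within {0..}) (\<lambda>t. integral {0..t} (g y))" by simp
    qed
    then have "continuous_on UNIV (\<lambda>t. integral {0..max 0 t} (g y))"
      by (rule continuous_on_compose2) (auto intro!: continuous_intros)
    then show ?thesis unfolding \<Phi>_def by (intro continuous_intros)
  qed
  have bcont: "\<Phi> y \<in> bcontfun" if y: "y \<in> bcontfun" for y
  proof -
    have cy: "continuous_on UNIV y" using y by (simp add: bcontfun_def)
    obtain B where B: "B > 0" "\<And>s. norm (y s) \<le> B"
      using y unfolding bcontfun_def bounded_pos by auto
    have "norm (\<Phi> y t) \<le> norm x0 + norm (f 0) / \<kappa> + B" for t
    proof -
      define r where "r = max 0 t"
      have r: "0 \<le> r" by (simp add: r_def)
      have hi: "((\<lambda>s. norm (f 0) + L * B * exp (\<kappa> * s)) has_integral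
          norm (f 0) * r + L * B * ((exp (\<kappa> * r) - 1) / \<kappa>)) {0..r}"
        using has_integral_add[OF has_integral_const_real[of "norm (f 0)" 0 r]
          has_integral_mult_right[OF has_integral_exp_mult[OF \<kappa> r], of "L * B"]] r by (simp add: mult_ac)
      have "norm (integral {0..r} (g y)) \<le> integral {0..r} (\<lambda>s. norm (f 0) + L * B * exp (\<kappa> * s))"
        by (rule integral_norm_bound_integral)
          (use hi norm_g[OF B(2)] cont_g[OF cy] in \<open>auto intro: integrable_continuous_real\<close>)
      also have "\<dots> = norm (f 0) * r + L * B * ((exp (\<kappa> * r) - 1) / \<kappa>)"
        using hi by (simp add: integral_unique)
      also have "\<dots> \<le> norm (f 0) / \<kappa> * exp (\<kappa> * r) + B * exp (\<kappa> * r)"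
      proof (rule add_mono)
        have "\<kappa> * r \<le> exp (\<kappa> * r)" using exp_ge_add_one_self[of "\<kappa> * r"] by linarith
        then show "norm (f 0) * r \<le> norm (f 0) / \<kappa> * exp (\<kappa> * r)"
          using \<kappa> mult_left_mono[of "\<kappa> * r" "exp (\<kappa> * r)" "norm (f 0)"] by (simp add: field_simps)
        show "L * B * ((exp (\<kappa> * r) - 1) / \<kappa>) \<le> B * exp (\<kappa> * r)"
          using L B(1) by (simp add: \<kappa>_def field_simps)
      qed
      finally have I: "norm (integral {0..r} (g y)) \<le> (norm (f 0) / \<kappa> + B) * exp (\<kappa> * r)"
        by (simp add: algebra_simps)
      have "norm (x0 + integral {0..r} (g y)) \<le> norm x0 * exp (\<kappa> * r) + (norm (f 0) / \<kappa> + B) * exp (\<kappa> * r)"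
        using norm_triangle_ineq[of x0 "integral {0..r} (g y)"] I \<kappa> r
          mult_left_mono[of 1 "exp (\<kappa> * r)" "norm x0"] by simp
      then have "exp (- \<kappa> * r) * norm (x0 + integral {0..r} (g y)) \<le>
         exp (- \<kappa> * r) * ((norm x0 + norm (f 0) / \<kappa> + B) * exp (\<kappa> * r))"
        by (intro mult_left_mono) (auto simp: algebra_simps)
      also have "\<dots> = norm x0 + norm (f 0) / \<kappa> + B" by (simp add: exp_minus field_simps)
      finally show ?thesis unfolding \<Phi>_def r_def by simp
    qed
    then show ?thesis by (intro bcontfun_normI cont_\<Phi> cy)
  qed
  define \<Psi> where "\<Psi> y = Bcontfun (\<Phi> (apply_bcontfun y))" for y :: "real \<Rightarrow>\<^sub>C 'a"
  have \<Psi>: "apply_bcontfun (\<Psi> y) = \<Phi> (apply_bcontfun y)" for y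
    unfolding \<Psi>_def by (rule Bcontfun_inverse) (rule bcont, simp add: apply_bcontfun)
  have "\<exists>!y. \<Psi> y = y"
  proof (rule banach_fix_type[where c = "1/2"]; (intro allI)?)
    fix y z :: "real \<Rightarrow>\<^sub>C 'a"
    define B where "B = dist y z"
    have B: "norm (apply_bcontfun y s - apply_bcontfun z s) \<le> B" for s
      unfolding B_def using dist_bounded[of y s z] by (simp add: dist_norm)
    have "B \<ge> 0" by (simp add: B_def)
    have "dist (\<Phi> (apply_bcontfun y) t) (\<Phi> (apply_bcontfun z) t) \<le> 1/2 * B" for t
    proof -
      define r where "r = max 0 t"
      have r: "0 \<le> r" by (simp add: r_def)
      have hi: "((\<lambda>s. L * B * exp (\<kappa> * s)) has_integral L * B * ((exp (\<kappa> * r) - 1) / \<kappa>)) {0..r}"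
        by (rule has_integral_mult_right[OF has_integral_exp_mult[OF \<kappa> r]])
      have int: "g (apply_bcontfun y) integrable_on {0..r}" for y :: "real \<Rightarrow>\<^sub>C 'a"
        by (intro integrable_continuous_real cont_g) simp
      have "norm (integral {0..r} (g y) - integral {0..r} (g z)) = norm (integral {0..r} (\<lambda>s. g y s - g z s))"
        using int by (simp add: Henstock_Kurzweil_Integration.integral_diff)
      also have "\<dots> \<le> integral {0..r} (\<lambda>s. L * B * exp (\<kappa> * s))"
        by (rule integral_norm_bound_integral)
          (use hi norm_diff[OF B] int in \<open>auto intro!: Henstock_Kurzweil_Integration.integrable_diff\<close>)
      also have "\<dots> = L * B * ((exp (\<kappa> * r) - 1) / \<kappa>)" by (rule integral_unique[OF hi])
      also have "\<dots> \<le> 1/2 * B * exp (\<kappa> * r)"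
        using L \<open>B \<ge> 0\<close> by (simp add: \<kappa>_def field_simps)
      finally have I: "norm (integral {0..r} (g y) - integral {0..r} (g z)) \<le> 1/2 * B * exp (\<kappa> * r)" .
      have "dist (\<Phi> y t) (\<Phi> z t) = exp (- \<kappa> * r) * norm (integral {0..r} (g y) - integral {0..r} (g z))"
        unfolding \<Phi>_def dist_norm r_def by (simp flip: scaleR_diff_right)
      also have "\<dots> \<le> exp (- \<kappa> * r) * (1/2 * B * exp (\<kappa> * r))"
        using I by (intro mult_left_mono) auto
      also have "\<dots> = 1/2 * B" by (simp add: exp_minus field_simps)
      finally show ?thesis .
    qed
    then show "dist (\<Psi> y) (\<Psi> z) \<le> 1/2 * dist y z"
      unfolding bcontfun_dist_le_iff \<Psi> B_def by blast
  qed auto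
  then obtain y where "\<Psi> y = y" by blast
  then have y: "apply_bcontfun y t = \<Phi> (apply_bcontfun y) t" for t
    by (metis \<Psi>)
  define x where "x t = exp (\<kappa> * t) *\<^sub>R apply_bcontfun y t" for t
  have x: "x t = x0 + integral {0..t} (\<lambda>s. f (x s))" if "t \<ge> 0" for t
  proof -
    have "x t = exp (\<kappa> * t) *\<^sub>R (exp (- \<kappa> * t) *\<^sub>R (x0 + integral {0..t} (g y)))"
      unfolding x_def using that by (subst y) (simp add: \<Phi>_def max_def)
    also have "\<dots> = x0 + integral {0..t} (g y)"
      by (simp add: exp_minus)
    finally show ?thesis by (simp add: g_def[abs_def] x_def)
  qed
  have cont_x: "continuous_on S (\<lambda>s. f (x s))" for S
    using cont_g[of "apply_bcontfun y" S] by (simp add: g_def[abs_def] x_def)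
  have "(x has_vector_derivative f (x t)) (at t within {0..})" if t: "t \<ge> 0" for t
  proof -
    have "((\<lambda>t. integral {0..t} (\<lambda>s. f (x s))) has_vector_derivative f (x t)) (at t within {0..t+1})"
      by (rule integral_has_vector_derivative) (use cont_x t in auto)
    then have "((\<lambda>t. x0 + integral {0..t} (\<lambda>s. f (x s))) has_vector_derivative f (x t)) (at t within {0..t+1})"
      by (auto intro!: derivative_eq_intros)
    then have "(x has_vector_derivative f (x t)) (at t within {0..t+1})"
      by (rule has_vector_derivative_transform[rotated 2]) (use t x in auto)
    moreover have "at t within {0..t+1} = at t within {0..}"
      by (rule at_within_nhd[where S="{..<t+1}"]) auto
    ultimately show ?thesis by simp
  qed
  moreover have "x 0 = x0" using x[of 0] by simp
  ultimately show ?thesis by blast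
qed

lemma bounded_linear_apply_bcontfun: "bounded_linear (\<lambda>f :: 'a::topological_space \<Rightarrow>\<^sub>C 'b::real_normed_vector. apply_bcontfun f i)"
  by (rule bounded_linear_intro[where K=1]) (auto intro: norm_bounded)

instance bcontfun :: (metric_space, banach) banach ..

text \<open>Clipping each factor of a quadratic right-hand side makes it bounded and globally
  Lipschitz, and does not change the equation along solutions with values in [0, R]. The cut at 0
  also drives the positivity argument.\<close>

definition clip :: "real \<Rightarrow> real \<Rightarrow> real" where
  "clip R r = max 0 (min r R)"

lemma clip_bounds: "0 \<le> R \<Longrightarrow> 0 \<le> clip R r" "0 \<le> R \<Longrightarrow> clip R r \<le> R"
  and clip_diff: "\<bar>clip R r - clip R s\<bar> \<le> \<bar>r - s\<bar>"
  and clip_id: "0 \<le> r \<Longrightarrow> r \<le> R \<Longrightarrow> clip R r = r"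
  and clip_neg: "r \<le> 0 \<Longrightarrow> clip R r = 0"
  by (auto simp: clip_def)

lemma clip_prod_diff:
  assumes R: "0 \<le> R" and "\<bar>r - r'\<bar> \<le> d" "\<bar>s - s'\<bar> \<le> d"
  shows "\<bar>clip R r * clip R s - clip R r' * clip R s'\<bar> \<le> 2 * R * d"
proof -
  have "clip R r * clip R s - clip R r' * clip R s' = (clip R r - clip R r') * clip R s + clip R r' * (clip R s - clip R s')"
    by (simp add: algebra_simps)
  also have "\<bar>\<dots>\<bar> \<le> \<bar>clip R r - clip R r'\<bar> * clip R s + clip R r' * \<bar>clip R s - clip R s'\<bar>"
    using abs_triangle_ineq[of "(clip R r - clip R r') * clip R s" "clip R r' * (clip R s - clip R s')"]
      clip_bounds[OF R] by (simp add: abs_mult)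
  also have "\<dots> \<le> d * R + R * d"
    using clip_bounds[OF R] assms clip_diff[of R r r'] clip_diff[of R s s']
    by (intro add_mono mult_mono) auto
  finally show ?thesis by simp
qed

subsection \<open>Sums over the positive integers\<close>

lemma has_sum_product_nonneg:
  fixes f g :: "_ \<Rightarrow> real"
  assumes f: "(f has_sum F) A" and g: "(g has_sum G) B"
    and nonneg: "\<And>x. x \<in> A \<Longrightarrow> 0 \<le> f x" "\<And>y. y \<in> B \<Longrightarrow> 0 \<le> g y"
  shows "((\<lambda>(x, y). f x * g y) has_sum F * G) (A \<times> B)"
proof (rule has_sum_SigmaI)
  show *: "((\<lambda>y. case (x, y) of (x, y) \<Rightarrow> f x * g y) has_sum f x * G) B" for x
    using has_sum_cmult_right[OF g] by simp
  show **: "((\<lambda>x. f x * G) has_sum F * G) A"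
    using has_sum_cmult_left[OF f] by simp
  show "(\<lambda>(x, y). f x * g y) summable_on A \<times> B"
    by (rule summable_on_SigmaI[OF *]) (use ** nonneg in \<open>auto simp: summable_on_def\<close>)
qed

lemma has_sum_sum:
  fixes f :: "'i \<Rightarrow> 'a \<Rightarrow> real"
  assumes "finite I" "\<And>i. i \<in> I \<Longrightarrow> (f i has_sum S i) A"
  shows "((\<lambda>x. \<Sum>i\<in>I. f i x) has_sum (\<Sum>i\<in>I. S i)) A"
  using assms by (induction I) (auto intro: has_sum_add)

lemma
  fixes f :: "nat \<Rightarrow> real"
  assumes nonneg: "\<And>i. 1 \<le> i \<Longrightarrow> 0 \<le> f i" and le: "\<And>n. (\<Sum>i=1..n. f i) \<le> K"
  shows summable_on_partial_sums_le: "f summable_on {1..}"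
    and infsum_partial_sums_le: "(\<Sum>\<^sub>\<infinity>i\<in>{1..}. f i) \<le> K"
proof -
  have fin: "sum f F \<le> K" if "finite F" "F \<subseteq> {1..}" for F
  proof -
    have "sum f F \<le> sum f {1..Max (insert 0 F)}"
      by (rule sum_mono2) (use that nonneg in auto)
    also have "\<dots> \<le> K" by (rule le)
    finally show ?thesis .
  qed
  show s: "f summable_on {1..}"
    by (rule nonneg_bdd_above_summable_on) (use nonneg fin in \<open>auto intro!: bdd_aboveI2\<close>)
  show "(\<Sum>\<^sub>\<infinity>i\<in>{1..}. f i) \<le> K"
    by (rule infsum_le_finite_sums[OF s]) (use fin in auto)
qed

lemma sum_le_infsum_atLeast1:
  fixes f :: "nat \<Rightarrow> real"
  assumes "f summable_on {1..}" "\<And>i. 1 \<le> i \<Longrightarrow> 0 \<le> f i"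
  shows "(\<Sum>i=1..n. f i) \<le> (\<Sum>\<^sub>\<infinity>i\<in>{1..}. f i)"
  by (rule finite_sum_le_infsum) (use assms in auto)

lemma summable_on_norm_le:
  fixes f g :: "_ \<Rightarrow> real"
  assumes "g summable_on A" "\<And>x. x \<in> A \<Longrightarrow> \<bar>f x\<bar> \<le> g x"
  shows "f summable_on A" "\<bar>infsum f A\<bar> \<le> infsum g A"
proof -
  show *: "f summable_on A"
    by (rule abs_summable_summable, rule Infinite_Sum.abs_summable_on_comparison_test'[OF assms(1)]) (use assms(2) in auto)
  show "\<bar>infsum f A\<bar> \<le> infsum g A"
    using norm_infsum_le[OF has_sum_infsum[OF *] has_sum_infsum[OF assms(1)]] assms(2) by auto
qed

lemma sum_atLeast1_tendsto_infsum:
  fixes f :: "nat \<Rightarrow> real"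
  assumes "f summable_on {1..}"
  shows "(\<lambda>n. \<Sum>i=1..n. f i) \<longlonglongrightarrow> (\<Sum>\<^sub>\<infinity>i\<in>{1..}. f i)"
proof -
  have "((\<lambda>i. if 1 \<le> i then f i else 0) has_sum (\<Sum>\<^sub>\<infinity>i\<in>{1..}. f i)) UNIV"
    using has_sum_infsum[OF assms] by (subst has_sum_cong_neutral[where T="{1..}" and g=f]) auto
  from has_sum_imp_sums[OF this]
  have "(\<lambda>n. \<Sum>i<Suc n. if 1 \<le> i then f i else 0) \<longlonglongrightarrow> (\<Sum>\<^sub>\<infinity>i\<in>{1..}. f i)"
    unfolding sums_def by (rule LIMSEQ_Suc)
  moreover have "(\<Sum>i<Suc n. if 1 \<le> i then f i else 0) = (\<Sum>i=1..n. f i)" for n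
    by (rule sum.mono_neutral_cong_right) auto
  ultimately show ?thesis by simp
qed

subsection \<open>Pointwise estimates for the collision operator\<close>

locale collision_kernel =
  fixes a :: "nat \<Rightarrow> nat \<Rightarrow> real"
    and b :: "nat \<Rightarrow> nat \<Rightarrow> nat \<Rightarrow> real"
    and \<gamma> A :: real
  assumes a_nonneg: "\<And>i j. i \<ge> 1 \<Longrightarrow> j \<ge> 1 \<Longrightarrow> 0 \<le> a i j"
    and gamma: "0 \<le> \<gamma>" "\<gamma> \<le> 1"
    and A_pos: "0 < A"
    and a_bound: "\<And>i j. i \<ge> 1 \<Longrightarrow> j \<ge> 1 \<Longrightarrow> a i j \<le> A * (real i * real j) powr \<gamma>"
    and b_nonneg: "\<And>i j k. 1 \<le> i \<Longrightarrow> i \<le> j - 1 \<Longrightarrow> j \<ge> 2 \<Longrightarrow> k \<ge> 1 \<Longrightarrow> 0 \<le> b i j k"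
    and b_mass: "\<And>j k. j \<ge> 2 \<Longrightarrow> k \<ge> 1 \<Longrightarrow> (\<Sum>i=1..j-1. real i * b i j k) = real j"
begin

text \<open>A common bound on all partial sums encodes summability and the size of the moment at
  once, and it passes to pointwise limits without interchanging limit and series.\<close>

definition admissible :: "real \<Rightarrow> (nat \<Rightarrow> real) \<Rightarrow> bool" where
  "admissible K y \<longleftrightarrow> (\<forall>i\<ge>1. 0 \<le> y i) \<and> (\<forall>n. (\<Sum>i=1..n. real i powr (1 + \<gamma>) * y i) \<le> K)"

definition mom :: "(nat \<Rightarrow> real) \<Rightarrow> real" where
  "mom y = (\<Sum>\<^sub>\<infinity>i\<in>{1..}. real i powr (1 + \<gamma>) * y i)"

definition mass :: "(nat \<Rightarrow> real) \<Rightarrow> real" where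
  "mass y = (\<Sum>\<^sub>\<infinity>i\<in>{1..}. real i * y i)"

text \<open>No condition constrains \<open>b i j k\<close> for i \<ge> j. Extending by zero there
  lets every sum over cluster sizes run over the same index set.\<close>

definition frag :: "nat \<Rightarrow> nat \<Rightarrow> nat \<Rightarrow> real" where
  "frag i j k = (if i < j then b i j k else 0)"

text \<open>The net effect on the clusters of size i of a collision in which j breaks against k:
  fragments gained, minus the cluster j itself if j = i. The loss becomes the row j = i of the gain
  array, so a single double series carries the whole right-hand side.\<close>

definition coef :: "nat \<Rightarrow> nat \<Rightarrow> nat \<Rightarrow> real" where
  "coef i j k = (frag i j k - (if j = i then 1 else 0)) * a j k"

definition rate :: "nat \<Rightarrow> (nat \<Rightarrow> real) \<Rightarrow> real" where
  "rate i y = (\<Sum>\<^sub>\<infinity>(j, k)\<in>{1..} \<times> {1..}. coef i j k * y j * y k)"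

text \<open>
  Absolute values are taken in the gain, but the loss keeps its sign in $|u_i|$: after multiplication
  by \<open>i\<close> and summation this is what cancels the $|u_j|$ part of the gain, for $u = y - z$.
\<close>

definition diff_bound_term :: "nat \<Rightarrow> (nat \<Rightarrow> real) \<Rightarrow> (nat \<Rightarrow> real) \<Rightarrow> nat \<Rightarrow> nat \<Rightarrow> real" where
  "diff_bound_term i y z j k = a j k / 2 *
     (frag i j k * (\<bar>y j - z j\<bar> * (y k + z k) + \<bar>y k - z k\<bar> * (y j + z j)) +
      (if j = i then \<bar>y k - z k\<bar> * (y j + z j) - \<bar>y j - z j\<bar> * (y k + z k) else 0))"

definition diff_bound :: "nat \<Rightarrow> (nat \<Rightarrow> real) \<Rightarrow> (nat \<Rightarrow> real) \<Rightarrow> real" where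
  "diff_bound i y z = (\<Sum>\<^sub>\<infinity>(j, k)\<in>{1..} \<times> {1..}. diff_bound_term i y z j k)"

section \<open>Bounds on single coefficients from the growth condition and the mass balance\<close>

lemma real_le_powr: "real i \<le> real i powr (1 + \<gamma>)" if "1 \<le> i"
  using that gamma powr_mono[of 1 "1 + \<gamma>" "real i"] by simp

text \<open>The weight j raises j^\<gamma> to j^(1 + \<gamma>), while k^\<gamma> \<le> k because
  \<gamma> \<le> 1. This asymmetric split decides which factor of a product is measured by
  \<open>mom\<close> and which by \<open>mass\<close>.\<close>

lemma mult_a_le: "real j * a j k \<le> A * (real j powr (1 + \<gamma>) * real k)" if "1 \<le> j" "1 \<le> k"
proof -
  have "a j k \<le> A * (real j powr \<gamma> * real k powr \<gamma>)"
    using a_bound[OF that] by (simp add: powr_mult)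
  also have "\<dots> \<le> A * (real j powr \<gamma> * real k)"
    using A_pos gamma that powr_mono[of \<gamma> 1 "real k"] by (intro mult_left_mono) auto
  finally have "real j * a j k \<le> real j * (A * (real j powr \<gamma> * real k))"
    by (rule mult_left_mono) simp
  then show ?thesis using that by (simp add: powr_add mult_ac)
qed

lemma frag_nonneg: "0 \<le> frag i j k" if "1 \<le> i" "1 \<le> k"
  using b_nonneg[of i j k] that by (auto simp: frag_def)

text \<open>The mass balance survives only as an inequality: cutting at n discards nonnegative
  terms, and a cluster of size 1 has no fragments at all.\<close>

lemma sum_frag_le: "(\<Sum>i=1..n. real i * frag i j k) \<le> real j" if "1 \<le> k"
proof (cases "2 \<le> j")
  case True
  have "(\<Sum>i=1..n. real i * frag i j k) \<le> (\<Sum>i=1..max n (j-1). real i * frag i j k)"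
    by (rule sum_mono2) (use frag_nonneg that in auto)
  also have "\<dots> = (\<Sum>i=1..j-1. real i * frag i j k)"
    by (rule sum.mono_neutral_right) (auto simp: frag_def)
  also have "\<dots> = (\<Sum>i=1..j-1. real i * b i j k)"
    by (rule sum.cong) (auto simp: frag_def)
  finally show ?thesis using b_mass[OF True that] by simp
next
  case False
  then have "(\<Sum>i=1..n. real i * frag i j k) = 0"
    by (intro sum.neutral) (auto simp: frag_def)
  then show ?thesis by simp
qed

text \<open>The left side is one term of the mass balance, taken there with a weight i \<ge>
  1.\<close>

lemma frag_le: "frag i j k \<le> real j" if "1 \<le> i" "1 \<le> k"
proof -
  have "frag i j k \<le> real i * frag i j k"
    using that frag_nonneg[OF that, of j] by (simp add: mult_le_cancel_right1)
  also have "\<dots> \<le> (\<Sum>i=1..i. real i * frag i j k)"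
    by (rule member_le_sum) (use that frag_nonneg in auto)
  also have "\<dots> \<le> real j" by (rule sum_frag_le[OF that(2)])
  finally show ?thesis .
qed

lemma abs_coef_le: "\<bar>coef i j k\<bar> \<le> real j * a j k" if "1 \<le> i" "1 \<le> j" "1 \<le> k"
proof -
  have "\<bar>frag i j k - (if j = i then 1 else 0)\<bar> \<le> real j"
    using frag_nonneg[OF that(1,3), of j] frag_le[OF that(1,3), of j] that by (auto simp: frag_def)
  then show ?thesis
    using a_nonneg[OF that(2,3)] by (auto simp: coef_def abs_mult intro: mult_right_mono)
qed

section \<open>Moments of admissible sequences\<close>

lemma admissible_nonneg: "admissible K y \<Longrightarrow> 1 \<le> i \<Longrightarrow> 0 \<le> y i"
  by (simp add: admissible_def)

lemma admissible_K_nonneg: "admissible K y \<Longrightarrow> 0 \<le> K"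
  unfolding admissible_def by (metis atLeastatMost_empty' not_one_le_zero sum.empty)

lemma
  assumes "admissible K y"
  shows admissible_summable: "(\<lambda>i. real i powr (1 + \<gamma>) * y i) summable_on {1..}"
    and mom_le: "mom y \<le> K"
  using assms unfolding admissible_def mom_def
  by (intro summable_on_partial_sums_le[where K = K] infsum_partial_sums_le; simp)+

lemma
  assumes "admissible K y"
  shows admissible_summable1: "(\<lambda>i. real i * y i) summable_on {1..}"
    and mass_le_mom: "mass y \<le> mom y"
proof -
  have le: "real i * y i \<le> real i powr (1 + \<gamma>) * y i" if "1 \<le> i" for i
    using real_le_powr[OF that] admissible_nonneg[OF assms that] by (rule mult_right_mono)
  show s: "(\<lambda>i. real i * y i) summable_on {1..}"
    by (rule summable_on_comparison_test[OF admissible_summable[OF assms]])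
       (use le admissible_nonneg[OF assms] in auto)
  show "mass y \<le> mom y"
    unfolding mass_def mom_def by (rule infsum_mono[OF s admissible_summable[OF assms]]) (use le in auto)
qed

lemma mass_nonneg: "admissible K y \<Longrightarrow> 0 \<le> mass y"
  unfolding mass_def by (rule infsum_nonneg) (auto simp: admissible_nonneg)

lemma mom_nonneg: "admissible K y \<Longrightarrow> 0 \<le> mom y"
  unfolding mom_def by (rule infsum_nonneg) (auto simp: admissible_nonneg)

lemma mass_le: "admissible K y \<Longrightarrow> mass y \<le> K"
  using mass_le_mom mom_le order_trans by blast

lemma admissible_mono:
  assumes "admissible K y" "\<And>i. 1 \<le> i \<Longrightarrow> 0 \<le> x i" "\<And>i. 1 \<le> i \<Longrightarrow> x i \<le> y i"
  shows "admissible K x"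
  unfolding admissible_def
proof (intro conjI allI impI)
  fix n
  have "(\<Sum>i=1..n. real i powr (1 + \<gamma>) * x i) \<le> (\<Sum>i=1..n. real i powr (1 + \<gamma>) * y i)"
    by (intro sum_mono mult_left_mono) (use assms in auto)
  then show "(\<Sum>i=1..n. real i powr (1 + \<gamma>) * x i) \<le> K"
    using assms(1) unfolding admissible_def by (meson order_trans)
qed (use assms in auto)

lemma admissible_add: "admissible K y \<Longrightarrow> admissible K' z \<Longrightarrow> admissible (K + K') (\<lambda>i. y i + z i)"
  unfolding admissible_def by (auto simp: distrib_left sum.distrib intro: add_mono)

lemma admissible_abs_diff: "admissible K y \<Longrightarrow> admissible K' z \<Longrightarrow> admissible (K + K') (\<lambda>i. \<bar>y i - z i\<bar>)"
  by (rule admissible_mono[OF admissible_add]) (auto simp: admissible_def abs_le_iff)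

text \<open>By \<open>mult_a_le\<close> the dominating array is bounded by a product of a sequence
  in j and a sequence in k, whose double sum factorizes. The estimates of the double series below
  all reduce to this comparison, with x and z chosen among sums, differences and tails.\<close>

lemma bilinear_dominated:
  assumes x: "admissible K x" and z: "admissible K' z"
    and c: "\<And>j k. 1 \<le> j \<Longrightarrow> 1 \<le> k \<Longrightarrow> \<bar>c (j, k)\<bar> \<le> real j * a j k * x j * z k"
  shows "c summable_on {1..} \<times> {1..}" "\<bar>infsum c ({1..} \<times> {1..})\<bar> \<le> A * mom x * mass z"
proof -
  have hs: "((\<lambda>(j, k). (A * (real j powr (1 + \<gamma>) * x j)) * (real k * z k)) has_sum (A * mom x) * mass z) ({1..} \<times> {1..})"
    unfolding mom_def mass_def
    by (intro has_sum_product_nonneg has_sum_cmult_right has_sum_infsum admissible_summable[OF x] admissible_summable1[OF z])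
       (use A_pos admissible_nonneg[OF x] admissible_nonneg[OF z] in auto)
  have le: "\<bar>c jk\<bar> \<le> (case jk of (j, k) \<Rightarrow> (A * (real j powr (1 + \<gamma>) * x j)) * (real k * z k))"
    if jk: "jk \<in> {1..} \<times> {1..}" for jk
  proof -
    obtain j k where [simp]: "jk = (j, k)" and jk: "1 \<le> j" "1 \<le> k" using jk by auto
    have "\<bar>c (j, k)\<bar> \<le> real j * a j k * (x j * z k)" using c[OF jk] by (simp add: mult_ac)
    also have "\<dots> \<le> A * (real j powr (1 + \<gamma>) * real k) * (x j * z k)"
      by (rule mult_right_mono[OF mult_a_le[OF jk]]) (use admissible_nonneg[OF x] admissible_nonneg[OF z] jk in auto)
    finally show ?thesis by (simp add: mult_ac)
  qed
  show "c summable_on {1..} \<times> {1..}" "\<bar>infsum c ({1..} \<times> {1..})\<bar> \<le> A * mom x * mass z"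
    using summable_on_norm_le[OF has_sum_imp_summable[OF hs], of c] le infsumI[OF hs] by auto
qed

lemma
  assumes i: "1 \<le> i" and y: "admissible K y"
  shows rate_summable: "(\<lambda>(j, k). coef i j k * y j * y k) summable_on {1..} \<times> {1..}"
    and abs_rate_le: "\<bar>rate i y\<bar> \<le> A * K * K"
proof -
  have "\<bar>case (j, k) of (j, k) \<Rightarrow> coef i j k * y j * y k\<bar> \<le> real j * a j k * y j * y k"
    if "1 \<le> j" "1 \<le> k" for j k
    using mult_right_mono[OF abs_coef_le[OF i that], of "y j * y k"] admissible_nonneg[OF y] that
    by (simp add: abs_mult mult_ac)
  note * = bilinear_dominated[OF y y this]
  show "(\<lambda>(j, k). coef i j k * y j * y k) summable_on {1..} \<times> {1..}" using *(1) by simp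
  have "\<bar>rate i y\<bar> \<le> A * mom y * mass y" using *(2) by (simp add: rate_def)
  also have "\<dots> \<le> A * K * K"
    using A_pos mom_le[OF y] mass_le[OF y] mom_nonneg[OF y] mass_nonneg[OF y]
    by (intro mult_mono) auto
  finally show "\<bar>rate i y\<bar> \<le> A * K * K" .
qed

text \<open>No cancellation is used here, so the difference has to be measured in the moment of
  order 1 + \<gamma>. That is too weak for stability, but enough for passing to the limit in the
  equation. The constant comes from \<open>y + z\<close>, whose moments are at most 2 K.\<close>

lemma abs_rate_diff_le:
  assumes i: "1 \<le> i" and y: "admissible K y" and z: "admissible K z"
  shows "\<bar>rate i y - rate i z\<bar> \<le> 2 * A * K * mom (\<lambda>i. \<bar>y i - z i\<bar>)"
proof -
  define u S where "u j = \<bar>y j - z j\<bar>" and "S j = y j + z j" for j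
  have u: "admissible (K + K) u" and S: "admissible (K + K) S"
    using admissible_abs_diff[OF y z] admissible_add[OF y z] by (auto simp: u_def[abs_def] S_def[abs_def])
  define c1 c2 where "c1 = (\<lambda>(j, k). real j * a j k * u j * S k)" and "c2 = (\<lambda>(j, k). real j * a j k * S j * u k)"
  have c1: "c1 summable_on {1..} \<times> {1..}" "\<bar>infsum c1 ({1..} \<times> {1..})\<bar> \<le> A * mom u * mass S"
    by (rule bilinear_dominated[OF u S]; use admissible_nonneg[OF u] admissible_nonneg[OF S] a_nonneg in \<open>simp add: c1_def\<close>)+
  have c2: "c2 summable_on {1..} \<times> {1..}" "\<bar>infsum c2 ({1..} \<times> {1..})\<bar> \<le> A * mom S * mass u"
    by (rule bilinear_dominated[OF S u]; use admissible_nonneg[OF u] admissible_nonneg[OF S] a_nonneg in \<open>simp add: c2_def\<close>)+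
  have diff: "((\<lambda>jk. (case jk of (j, k) \<Rightarrow> coef i j k * y j * y k) + - (case jk of (j, k) \<Rightarrow> coef i j k * z j * z k))
      has_sum (rate i y + - rate i z)) ({1..} \<times> {1..})"
    unfolding rate_def
    by (intro has_sum_add has_sum_uminusI has_sum_infsum rate_summable[OF i y] rate_summable[OF i z])
  have sum12: "((\<lambda>jk. 1/2 * (c1 jk + c2 jk)) has_sum (1/2 * (infsum c1 ({1..} \<times> {1..}) + infsum c2 ({1..} \<times> {1..})))) ({1..} \<times> {1..})"
    by (intro has_sum_add has_sum_cmult_right has_sum_infsum c1 c2)
  have "norm (rate i y + - rate i z) \<le> 1/2 * (infsum c1 ({1..} \<times> {1..}) + infsum c2 ({1..} \<times> {1..}))"
  proof (rule norm_infsum_le[OF diff sum12])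
    fix jk :: "nat \<times> nat" assume "jk \<in> {1..} \<times> {1..}"
    then obtain j k where [simp]: "jk = (j, k)" and jk: "1 \<le> j" "1 \<le> k" by auto
    have "coef i j k * y j * y k - coef i j k * z j * z k = coef i j k * (y j * y k - z j * z k)"
      by (simp add: algebra_simps)
    moreover have "\<bar>y j * y k - z j * z k\<bar> \<le> 1/2 * (u j * S k + S j * u k)"
    proof -
      have "y j * y k - z j * z k = 1/2 * ((y j - z j) * S k + S j * (y k - z k))"
        by (simp add: S_def field_simps)
      also have "\<bar>\<dots>\<bar> \<le> 1/2 * (\<bar>y j - z j\<bar> * \<bar>S k\<bar> + \<bar>S j\<bar> * \<bar>y k - z k\<bar>)"
        using abs_triangle_ineq[of "(y j - z j) * S k" "S j * (y k - z k)"] by (simp add: abs_mult)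
      finally show ?thesis using admissible_nonneg[OF S] jk by (simp add: u_def)
    qed
    ultimately have "\<bar>coef i j k * y j * y k - coef i j k * z j * z k\<bar> \<le> (real j * a j k) * (1/2 * (u j * S k + S j * u k))"
      using mult_mono'[OF abs_coef_le[OF i, of j k], of "\<bar>y j * y k - z j * z k\<bar>" "1/2 * (u j * S k + S j * u k)"] i jk
      by (simp only: abs_mult)
    then show "norm ((case jk of (j, k) \<Rightarrow> coef i j k * y j * y k) + - (case jk of (j, k) \<Rightarrow> coef i j k * z j * z k))
        \<le> 1/2 * (c1 jk + c2 jk)"
      by (simp add: c1_def c2_def distrib_left mult.assoc)
  qed
  also have "\<dots> \<le> 1/2 * (A * mom u * mass S + A * mom S * mass u)"
    using abs_le_D1[OF c1(2)] abs_le_D1[OF c2(2)] by simp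
  also have "\<dots> \<le> 1/2 * (A * mom u * (2 * K) + A * (2 * K) * mom u)"
    using A_pos mom_nonneg[OF u] mass_le[OF S] mom_le[OF S] mass_le_mom[OF u] mass_nonneg[OF u] mass_nonneg[OF S] admissible_K_nonneg[OF y]
    by (intro mult_left_mono add_mono mult_mono) auto
  finally show ?thesis by (simp add: u_def[abs_def])
qed

text \<open>\<open>abs_diff_bound_le\<close> is crude and serves only integrability in time; the
  sharp estimate concerns the weighted sum over i.\<close>

lemma
  assumes i: "1 \<le> i" and y: "admissible K y" and z: "admissible K z"
  shows diff_bound_summable: "(\<lambda>(j, k). diff_bound_term i y z j k) summable_on {1..} \<times> {1..}"
    and abs_diff_bound_le: "\<bar>diff_bound i y z\<bar> \<le> 4 * A * K * K"
proof -
  define S where "S j = y j + z j" for j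
  have S: "admissible (K + K) S" using admissible_add[OF y z] by (auto simp: S_def[abs_def])
  have "\<bar>case (j, k) of (j, k) \<Rightarrow> diff_bound_term i y z j k\<bar> \<le> real j * a j k * S j * S k"
    if jk: "1 \<le> j" "1 \<le> k" for j k
  proof -
    define p q where "p = \<bar>y j - z j\<bar> * S k" and "q = \<bar>y k - z k\<bar> * S j"
    have S0: "0 \<le> S j" "0 \<le> S k" using admissible_nonneg[OF S] jk by auto
    have "\<bar>y j - z j\<bar> \<le> S j" "\<bar>y k - z k\<bar> \<le> S k"
      using admissible_nonneg[OF y] admissible_nonneg[OF z] jk by (auto simp: S_def abs_le_iff)
    then have pq: "0 \<le> p" "p \<le> S j * S k" "0 \<le> q" "q \<le> S j * S k"
      using S0 mult_right_mono[of "\<bar>y j - z j\<bar>" "S j" "S k"] mult_right_mono[of "\<bar>y k - z k\<bar>" "S k" "S j"]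
      by (auto simp: p_def q_def mult.commute)
    have "\<bar>frag i j k * (p + q) + (if j = i then q - p else 0)\<bar> \<le> real j * (2 * (S j * S k))"
    proof (cases "j = i")
      case True
      have "\<bar>q - p\<bar> \<le> 1 * (2 * (S j * S k))" using pq by auto
      also have "\<dots> \<le> real j * (2 * (S j * S k))" using jk S0 by (intro mult_right_mono) auto
      finally show ?thesis using True by (simp add: frag_def)
    next
      case False
      then show ?thesis using frag_nonneg[OF i jk(2), of j] frag_le[OF i jk(2), of j] pq
        by (auto simp: abs_mult intro!: mult_mono)
    qed
    then have "a j k / 2 * \<bar>frag i j k * (p + q) + (if j = i then q - p else 0)\<bar> \<le> a j k / 2 * (real j * (2 * (S j * S k)))"
      using a_nonneg[OF jk] by (intro mult_left_mono) auto
    moreover have "diff_bound_term i y z j k = a j k / 2 * (frag i j k * (p + q) + (if j = i then q - p else 0))"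
      by (simp add: diff_bound_term_def p_def q_def S_def)
    moreover have "\<bar>a j k / 2 * w\<bar> = a j k / 2 * \<bar>w\<bar>" for w
      using a_nonneg[OF jk] by (simp add: abs_mult)
    ultimately have "\<bar>diff_bound_term i y z j k\<bar> \<le> a j k / 2 * (real j * (2 * (S j * S k)))"
      by (simp only:)
    then show ?thesis by (simp add: mult_ac)
  qed
  note * = bilinear_dominated[OF S S this]
  show "(\<lambda>(j, k). diff_bound_term i y z j k) summable_on {1..} \<times> {1..}" using *(1) by simp
  have "\<bar>diff_bound i y z\<bar> \<le> A * mom S * mass S" using *(2) by (simp add: diff_bound_def)
  also have "\<dots> \<le> A * (K + K) * (K + K)"
    using A_pos mom_le[OF S] mass_le[OF S] mom_nonneg[OF S] mass_nonneg[OF S]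
    by (intro mult_mono) auto
  finally show "\<bar>diff_bound i y z\<bar> \<le> 4 * A * K * K" by (simp add: algebra_simps)
qed

text \<open>The number \<sigma> plays the role of the sign of u_i in the chain rule for |u_i|, with
  any value in [-1, 1] allowed at a zero. In the row j = i the identity \<sigma> u_i = |u_i| keeps
  the loss of u_i negative; everywhere else |\<sigma>| \<le> 1 is enough.\<close>

lemma sign_rate_diff_le:
  assumes i: "1 \<le> i" and y: "admissible K y" and z: "admissible K z"
    and \<sigma>: "\<bar>\<sigma>\<bar> \<le> 1" "\<sigma> * (y i - z i) = \<bar>y i - z i\<bar>"
  shows "\<sigma> * (rate i y - rate i z) \<le> diff_bound i y z"
proof -
  have hs: "((\<lambda>jk. \<sigma> * ((case jk of (j, k) \<Rightarrow> coef i j k * y j * y k) + - (case jk of (j, k) \<Rightarrow> coef i j k * z j * z k)))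
      has_sum \<sigma> * (rate i y + - rate i z)) ({1..} \<times> {1..})"
    unfolding rate_def
    by (intro has_sum_add has_sum_cmult_right has_sum_uminusI has_sum_infsum rate_summable[OF i y] rate_summable[OF i z])
  have "\<sigma> * (rate i y + - rate i z) \<le> diff_bound i y z"
    unfolding diff_bound_def
  proof (rule has_sum_mono[OF hs has_sum_infsum[OF diff_bound_summable[OF i y z]]], clarsimp)
    fix j k :: nat assume jk: "Suc 0 \<le> j" "Suc 0 \<le> k"
    define U V S T where "U = y j - z j" and "V = y k - z k" and "S = y j + z j" and "T = y k + z k"
    have ST: "0 \<le> S" "0 \<le> T" using admissible_nonneg[OF y] admissible_nonneg[OF z] jk by (auto simp: S_def T_def)
    have prod: "y j * y k - z j * z k = 1/2 * (U * T + V * S)"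
      by (simp add: U_def V_def S_def T_def field_simps)
    have sU: "\<sigma> * U \<le> \<bar>U\<bar>" "\<sigma> * V \<le> \<bar>V\<bar>" "- (\<sigma> * V) \<le> \<bar>V\<bar>"
    proof -
      have "\<bar>\<sigma> * x\<bar> \<le> \<bar>x\<bar>" for x
        using mult_right_mono[OF \<sigma>(1), of "\<bar>x\<bar>"] by (simp add: abs_mult)
      from this[of U] this[of V] show "\<sigma> * U \<le> \<bar>U\<bar>" "\<sigma> * V \<le> \<bar>V\<bar>" "- (\<sigma> * V) \<le> \<bar>V\<bar>"
        by linarith+
    qed
    have g: "frag i j k * (\<sigma> * (U * T + V * S)) \<le> frag i j k * (\<bar>U\<bar> * T + \<bar>V\<bar> * S)"
      using mult_right_mono[OF sU(1) ST(2)] mult_right_mono[OF sU(2) ST(1)] frag_nonneg[OF i, of k j] jk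
      by (intro mult_left_mono) (auto simp: algebra_simps)
    have l: "(if j = i then - (\<sigma> * (U * T + V * S)) else 0) \<le> (if j = i then \<bar>V\<bar> * S - \<bar>U\<bar> * T else 0)"
    proof (cases "j = i")
      case True
      then have "\<sigma> * U = \<bar>U\<bar>" using \<sigma>(2) by (simp add: U_def)
      then have "\<sigma> * (U * T) = \<bar>U\<bar> * T" by (metis mult.assoc)
      moreover have "- (\<sigma> * (V * S)) \<le> \<bar>V\<bar> * S"
        using mult_right_mono[OF sU(3) ST(1)] by (simp add: mult.assoc)
      ultimately have "- (\<sigma> * (U * T) + \<sigma> * (V * S)) \<le> \<bar>V\<bar> * S - \<bar>U\<bar> * T" by linarith
      then show ?thesis using True by (simp only: distrib_left if_True simp_thms)
    qed simp
    have "\<sigma> * (coef i j k * y j * y k - coef i j k * z j * z k)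
       = a j k / 2 * (frag i j k * (\<sigma> * (U * T + V * S)) + (if j = i then - (\<sigma> * (U * T + V * S)) else 0))"
    proof -
      have "\<sigma> * (coef i j k * y j * y k - coef i j k * z j * z k) = \<sigma> * (coef i j k * (y j * y k - z j * z k))"
        by (simp add: algebra_simps)
      also have "\<dots> = \<sigma> * (coef i j k * (1/2 * (U * T + V * S)))"
        unfolding prod ..
      also have "\<dots> = a j k / 2 * (frag i j k * (\<sigma> * W) + (if j = i then - (\<sigma> * W) else 0))"
        if "W = U * T + V * S" for W
        unfolding that[symmetric] by (simp add: coef_def algebra_simps)
      finally show ?thesis by simp
    qed
    also have "\<dots> \<le> a j k / 2 * (frag i j k * (\<bar>U\<bar> * T + \<bar>V\<bar> * S) + (if j = i then \<bar>V\<bar> * S - \<bar>U\<bar> * T else 0))"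
      using a_nonneg[of j k] jk by (intro mult_left_mono add_mono g l) auto
    also have "\<dots> = diff_bound_term i y z j k"
      by (simp add: diff_bound_term_def U_def V_def S_def T_def)
    finally show "\<sigma> * (coef i j k * y j * y k - coef i j k * z j * z k) \<le> diff_bound_term i y z j k" .
  qed
  then show ?thesis by simp
qed

text \<open>For fixed (j, k) put p = |u_j| (y_k + z_k) and q = |u_k| (y_j + z_j). The fragments
  contribute at most j (p + q) and the loss j (q - p), the latter only if j \<le> n. Thus p cancels
  for j \<le> n and 2 j q remains; for j > n the uncancelled j p forms the tail moment. The q part
  involves u only through its mass.\<close>

lemma weighted_diff_bound_le:
  assumes y: "admissible K y" and z: "admissible K z"
  shows "(\<Sum>i=1..n. real i * diff_bound i y z) \<le>
     2 * A * K * mass (\<lambda>i. \<bar>y i - z i\<bar>) + A * K * mom (\<lambda>i. if n < i then \<bar>y i - z i\<bar> else 0)"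
proof -
  define u S v where "u j = \<bar>y j - z j\<bar>" and "S j = y j + z j" and "v j = (if n < j then u j else 0)" for j
  have u: "admissible (K + K) u" and S: "admissible (K + K) S"
    using admissible_abs_diff[OF y z] admissible_add[OF y z] by (auto simp: u_def[abs_def] S_def[abs_def])
  have v: "admissible (K + K) v"
    by (rule admissible_mono[OF u]) (auto simp: v_def u_def)
  define c1 c2 where "c1 = (\<lambda>(j, k). real j * a j k * v j * S k)" and "c2 = (\<lambda>(j, k). real j * a j k * S j * u k)"
  have c1: "c1 summable_on {1..} \<times> {1..}" "\<bar>infsum c1 ({1..} \<times> {1..})\<bar> \<le> A * mom v * mass S"
    by (rule bilinear_dominated[OF v S]; use admissible_nonneg[OF v] admissible_nonneg[OF S] a_nonneg in \<open>simp add: c1_def\<close>)+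
  have c2: "c2 summable_on {1..} \<times> {1..}" "\<bar>infsum c2 ({1..} \<times> {1..})\<bar> \<le> A * mom S * mass u"
    by (rule bilinear_dominated[OF S u]; use admissible_nonneg[OF u] admissible_nonneg[OF S] a_nonneg in \<open>simp add: c2_def\<close>)+
  have lhs: "((\<lambda>jk. \<Sum>i=1..n. real i * (case jk of (j, k) \<Rightarrow> diff_bound_term i y z j k))
      has_sum (\<Sum>i=1..n. real i * diff_bound i y z)) ({1..} \<times> {1..})"
    unfolding diff_bound_def
    by (intro has_sum_sum has_sum_cmult_right has_sum_infsum diff_bound_summable[OF _ y z]) auto
  have sum12: "((\<lambda>jk. 1/2 * c1 jk + c2 jk) has_sum (1/2 * infsum c1 ({1..} \<times> {1..}) + infsum c2 ({1..} \<times> {1..}))) ({1..} \<times> {1..})"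
    by (intro has_sum_add has_sum_cmult_right has_sum_infsum c1 c2)
  have "(\<Sum>i=1..n. real i * diff_bound i y z) \<le> 1/2 * infsum c1 ({1..} \<times> {1..}) + infsum c2 ({1..} \<times> {1..})"
  proof (rule has_sum_mono[OF lhs sum12], clarsimp)
    fix j k :: nat assume jk: "Suc 0 \<le> j" "Suc 0 \<le> k"
    define p q where "p = u j * S k" and "q = u k * S j"
    have pq: "0 \<le> p" "0 \<le> q" using admissible_nonneg[OF u] admissible_nonneg[OF S] jk by (auto simp: p_def q_def)
    define M where "M = (\<Sum>i=1..n. real i * frag i j k)"
    have M: "0 \<le> M" "M \<le> real j"
      using sum_frag_le[of k j n] frag_nonneg[of _ k j] jk by (auto simp: M_def intro!: sum_nonneg)
    have "(\<Sum>i=Suc 0..n. real i * diff_bound_term i y z j k)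
        = (\<Sum>i=1..n. a j k / 2 * (real i * frag i j k * (p + q) + (if i = j then real i * (q - p) else 0)))"
      by (intro sum.cong) (auto simp: diff_bound_term_def p_def q_def u_def S_def algebra_simps)
    also have "\<dots> = a j k / 2 * (M * (p + q) + (if j \<le> n then real j * (q - p) else 0))"
    proof -
      have "(\<Sum>i=1..n. real i * frag i j k * (p + q) + (if i = j then real i * (q - p) else 0))
          = M * (p + q) + (if j \<le> n then real j * (q - p) else 0)"
        using jk by (simp add: M_def sum.distrib flip: sum_distrib_right)
      then show ?thesis by (simp only: flip: sum_distrib_left)
    qed
    also have "\<dots> \<le> a j k / 2 * (real j * (2 * q) + (if n < j then real j * p else 0))"
    proof (rule mult_left_mono)
      have "M * (p + q) \<le> real j * (p + q)" using M pq by (intro mult_right_mono) auto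
      then show "M * (p + q) + (if j \<le> n then real j * (q - p) else 0) \<le> real j * (2 * q) + (if n < j then real j * p else 0)"
        using mult_nonneg_nonneg[OF of_nat_0_le_iff pq(2), of j] mult_nonneg_nonneg[OF of_nat_0_le_iff pq(1), of j]
          mult.left_commute[of "real j" 2 q]
        by (auto simp only: distrib_left right_diff_distrib split: if_split)
    qed (use a_nonneg[of j k] jk in auto)
    also have "\<dots> = c1 (j, k) / 2 + c2 (j, k)"
      by (auto simp: c1_def c2_def p_def q_def v_def algebra_simps)
    finally show "(\<Sum>i=Suc 0..n. real i * diff_bound_term i y z j k) \<le> c1 (j, k) / 2 + c2 (j, k)" .
  qed
  also have "\<dots> \<le> 1/2 * (A * mom v * mass S) + A * mom S * mass u"
    using c1(2) c2(2) by linarith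
  \<comment> \<open>Both moments of \<open>S\<close>, the sum of two sequences admissible for
    \<open>K\<close>, are at most 2 K.\<close>
  also have "\<dots> \<le> 1/2 * (A * mom v * (2 * K)) + A * (2 * K) * mass u"
    using A_pos mom_nonneg[OF v] mass_le[OF S] mom_le[OF S] mass_nonneg[OF u] admissible_K_nonneg[OF y]
    by (intro mult_left_mono add_mono mult_mono) auto
  finally show ?thesis by (simp add: u_def[abs_def] v_def[abs_def] mult_ac cong: if_cong)
qed

subsection \<open>Stability of trajectories\<close>

lemma mom_tail_tendsto_0:
  assumes y: "admissible K y"
  shows "(\<lambda>n. mom (\<lambda>i. if n < i then y i else 0)) \<longlonglongrightarrow> 0"
proof -
  have "mom (\<lambda>i. if n < i then y i else 0) = mom y - (\<Sum>i=1..n. real i powr (1 + \<gamma>) * y i)" for n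
  proof -
    have tail: "admissible K (\<lambda>i. if n < i then y i else 0)"
      by (rule admissible_mono[OF y]) (auto simp: admissible_nonneg[OF y])
    have "((\<lambda>i. if i \<le> n then real i powr (1 + \<gamma>) * y i else 0) has_sum (\<Sum>i=1..n. real i powr (1 + \<gamma>) * y i)) {1..}"
      by (rule has_sum_finite_neutralI[where B="{1..n}"]) auto
    from has_sum_add[OF has_sum_infsum[OF admissible_summable[OF tail]] this]
    have "((\<lambda>i. real i powr (1 + \<gamma>) * y i) has_sum
        (mom (\<lambda>i. if n < i then y i else 0) + (\<Sum>i=1..n. real i powr (1 + \<gamma>) * y i))) {1..}"
      unfolding mom_def by (rule has_sum_cong[THEN iffD1, rotated]) auto
    then have "mom y = mom (\<lambda>i. if n < i then y i else 0) + (\<Sum>i=1..n. real i powr (1 + \<gamma>) * y i)"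
      unfolding mom_def by (rule infsumI)
    then show ?thesis by simp
  qed
  moreover have "(\<lambda>n. mom y - (\<Sum>i=1..n. real i powr (1 + \<gamma>) * y i)) \<longlonglongrightarrow> mom y - mom y"
    unfolding mom_def
    by (intro tendsto_diff tendsto_const sum_atLeast1_tendsto_infsum admissible_summable[OF y])
  ultimately show ?thesis by simp
qed

section \<open>Measurability of the series along a trajectory\<close>

lemma borel_measurable_mom:
  assumes "\<And>i. 1 \<le> i \<Longrightarrow> u i \<in> borel_measurable M" "\<And>s. admissible K (\<lambda>i. u i s)"
  shows "(\<lambda>s. mom (\<lambda>i. u i s)) \<in> borel_measurable M"
  unfolding mom_def
  by (rule borel_measurable_infsum) (use assms(1) admissible_summable[OF assms(2)] in auto)

lemma borel_measurable_rate:
  assumes i: "1 \<le> i" and w: "\<And>i. 1 \<le> i \<Longrightarrow> w i \<in> borel_measurable M" and admissible: "\<And>s. admissible K (\<lambda>i. w i s)"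
  shows "(\<lambda>s. rate i (\<lambda>j. w j s)) \<in> borel_measurable M"
  unfolding rate_def
proof (rule borel_measurable_infsum)
  fix jk :: "nat \<times> nat" assume "jk \<in> {1..} \<times> {1..}"
  then show "(\<lambda>s. case jk of (j, k) \<Rightarrow> coef i j k * w j s * w k s) \<in> borel_measurable M"
    by (auto intro!: borel_measurable_times w)
qed (use rate_summable[OF i admissible] in auto)

lemma borel_measurable_diff_bound:
  assumes i: "1 \<le> i"
    and w: "\<And>i. 1 \<le> i \<Longrightarrow> w i \<in> borel_measurable M" "\<And>s. admissible K (\<lambda>i. w i s)"
    and v: "\<And>i. 1 \<le> i \<Longrightarrow> v i \<in> borel_measurable M" "\<And>s. admissible K (\<lambda>i. v i s)"
  shows "(\<lambda>s. diff_bound i (\<lambda>j. w j s) (\<lambda>j. v j s)) \<in> borel_measurable M"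
  unfolding diff_bound_def
proof (rule borel_measurable_infsum)
  fix jk :: "nat \<times> nat" assume "jk \<in> {1..} \<times> {1..}"
  then obtain j k where jk: "jk = (j, k)" "1 \<le> j" "1 \<le> k" by auto
  note [measurable] = w(1)[OF jk(2)] w(1)[OF jk(3)] v(1)[OF jk(2)] v(1)[OF jk(3)]
  show "(\<lambda>s. case jk of (j, k) \<Rightarrow> diff_bound_term i (\<lambda>j. w j s) (\<lambda>j. v j s) j k) \<in> borel_measurable M"
    unfolding diff_bound_term_def jk(1) prod.case by measurable
qed (use diff_bound_summable[OF i w(2) v(2)] in auto)

text \<open>
  A trajectory only has to solve the equation on \<open>[0, T]\<close>, but is defined and bounded for all times,
  so that no domain has to be carried along in measurability arguments.
\<close>

definition traj :: "real \<Rightarrow> real \<Rightarrow> (nat \<Rightarrow> real) \<Rightarrow> (nat \<Rightarrow> real \<Rightarrow> real) \<Rightarrow> bool" where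
  "traj K T w0 w \<longleftrightarrow> (\<forall>i\<ge>1. continuous_on UNIV (w i)) \<and> (\<forall>t. admissible K (\<lambda>i. w i t)) \<and>
    (\<forall>i\<ge>1. \<forall>t\<in>{0..T}. w i t = w0 i + (LINT s:{0<..<t}|lebesgue. rate i (\<lambda>j. w j s)))"

lemma traj_adm: "traj K T w0 w \<Longrightarrow> admissible K (\<lambda>i. w i t)"
  by (simp add: traj_def)

lemma traj_measurable: "traj K T w0 w \<Longrightarrow> 1 \<le> i \<Longrightarrow> w i \<in> borel_measurable lebesgue"
  by (simp add: traj_def borel_measurable_lebesgue_continuous)

lemma traj_rate_integrable:
  assumes "traj K T w0 w" "1 \<le> i"
  shows "set_integrable lebesgue {0<..<t} (\<lambda>s. rate i (\<lambda>j. w j s))"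
  by (rule set_integrable_bounded_Ioo[OF borel_measurable_rate abs_rate_le])
    (use assms traj_adm[OF assms(1)] traj_measurable[OF assms(1)] in auto)

lemma traj_initial: "traj K T w0 w \<Longrightarrow> 0 \<le> T \<Longrightarrow> 1 \<le> i \<Longrightarrow> w i 0 = w0 i"
  by (auto simp: traj_def set_lebesgue_integral_def)

lemma traj_abs_diff_le:
  assumes w: "traj K T w0 w" and v: "traj K T v0 v" and t: "0 < t" "t \<le> T" and i: "1 \<le> i"
  shows "\<bar>w i t - v i t\<bar> \<le> \<bar>w0 i - v0 i\<bar> + (LINT s:{0<..<t}|lebesgue. diff_bound i (\<lambda>j. w j s) (\<lambda>j. v j s))"
    and "set_integrable lebesgue {0<..<t} (\<lambda>s. diff_bound i (\<lambda>j. w j s) (\<lambda>j. v j s))"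
proof -
  show int: "set_integrable lebesgue {0<..<t} (\<lambda>s. diff_bound i (\<lambda>j. w j s) (\<lambda>j. v j s))"
    by (rule set_integrable_bounded_Ioo[OF borel_measurable_diff_bound abs_diff_bound_le])
      (use i traj_adm[OF w] traj_adm[OF v] traj_measurable[OF w] traj_measurable[OF v] in auto)
  have "\<bar>w i t - v i t\<bar> \<le> \<bar>w i 0 - v i 0\<bar> + (LINT s:{0<..<t}|lebesgue. diff_bound i (\<lambda>j. w j s) (\<lambda>j. v j s))"
  proof (rule abs_le_set_integral_of_sign_bound[where u = "\<lambda>t. w i t - v i t" and
        f = "\<lambda>s. rate i (\<lambda>j. w j s) - rate i (\<lambda>j. v j s)", OF t(1)])
    show "continuous_on {0..t} (\<lambda>t. w i t - v i t)"
      using w v i by (intro continuous_on_diff) (auto simp: traj_def intro: continuous_on_subset)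
    show "set_integrable lebesgue {0<..<t} (\<lambda>s. rate i (\<lambda>j. w j s) - rate i (\<lambda>j. v j s))"
      by (intro set_integral_diff traj_rate_integrable[OF w i] traj_rate_integrable[OF v i])
    fix r assume r: "0 \<le> r" "r \<le> t"
    then have "w i r - v i r = (w0 i - v0 i) + (LINT s:{0<..<r}|lebesgue. rate i (\<lambda>j. w j s)) - (LINT s:{0<..<r}|lebesgue. rate i (\<lambda>j. v j s))"
      using w v i t unfolding traj_def by auto
    also have "\<dots> = (w i 0 - v i 0) + (LINT s:{0<..<r}|lebesgue. rate i (\<lambda>j. w j s) - rate i (\<lambda>j. v j s))"
      using t traj_initial[OF w _ i] traj_initial[OF v _ i]
      by (simp add: set_integral_diff traj_rate_integrable[OF w i] traj_rate_integrable[OF v i])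
    finally show "w i r - v i r = (w i 0 - v i 0) + (LINT s:{0<..<r}|lebesgue. rate i (\<lambda>j. w j s) - rate i (\<lambda>j. v j s))" .
  next
    fix s \<sigma> :: real assume "\<bar>\<sigma>\<bar> \<le> 1" "\<sigma> * (w i s - v i s) = \<bar>w i s - v i s\<bar>"
    then show "\<sigma> * (rate i (\<lambda>j. w j s) - rate i (\<lambda>j. v j s)) \<le> diff_bound i (\<lambda>j. w j s) (\<lambda>j. v j s)"
      by (rule sign_rate_diff_le[OF i traj_adm[OF w] traj_adm[OF v]])
  qed (rule int)
  then show "\<bar>w i t - v i t\<bar> \<le> \<bar>w0 i - v0 i\<bar> + (LINT s:{0<..<t}|lebesgue. diff_bound i (\<lambda>j. w j s) (\<lambda>j. v j s))"
    using t traj_initial[OF w _ i] traj_initial[OF v _ i] by simp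
qed

text \<open>Gronwall by a weighted supremum: if m is the supremum of exp (- \<kappa> s) d(s) on
  [0, T], the integral inequality gives m \<le> D0 + m / 2. Since d(s) is replaced by m exp
  (\<kappa> s) before integrating, boundedness of d is all that is asked of it as a function of
  time. The factor 2 in front of D0 and the 2 in the exponent are the price.\<close>

lemma traj_stability:
  assumes w: "traj K T w0 w" and v: "traj K T v0 v"
    and D0: "\<And>n. (\<Sum>i=1..n. real i * \<bar>w0 i - v0 i\<bar>) \<le> D0"
    and t: "0 \<le> t" "t \<le> T"
  shows "mass (\<lambda>i. \<bar>w i t - v i t\<bar>) \<le> 2 * D0 * exp (2 * (2 * A * K + 1) * t)"
proof -
  define d where "d s = mass (\<lambda>i. \<bar>w i s - v i s\<bar>)" for s
  \<comment> \<open>The summand 1 keeps C positive when K = 0. With \<kappa> = 2 C, the function C m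
    exp (\<kappa> s) has the primitive m / 2 exp (\<kappa> s), which produces the contraction factor
    1/2.\<close>
  define C \<kappa> where "C = 2 * A * K + 1" and "\<kappa> = 2 * C"
  define m where "m = (SUP s\<in>{0..T}. d s * exp (- (\<kappa> * s)))"
  have K: "0 \<le> K" by (rule admissible_K_nonneg[OF traj_adm[OF w]])
  have C: "0 < C" "2 * A * K \<le> C" using A_pos K by (simp_all add: C_def add_nonneg_pos)
  have u: "admissible (K + K) (\<lambda>i. \<bar>w i s - v i s\<bar>)" for s
    by (rule admissible_abs_diff[OF traj_adm[OF w] traj_adm[OF v]])
  have d: "0 \<le> d s" "d s \<le> K + K" for s
    unfolding d_def using mass_nonneg[OF u] mass_le[OF u] by auto
  have bdd: "bdd_above ((\<lambda>s. d s * exp (- (\<kappa> * s))) ` {0..T})"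
  proof (rule bdd_aboveI2)
    fix s assume "s \<in> {0..T}"
    then have "d s * exp (- (\<kappa> * s)) \<le> (K + K) * 1"
      using d C K by (intro mult_mono) (auto simp: \<kappa>_def)
    then show "d s * exp (- (\<kappa> * s)) \<le> K + K" by simp
  qed
  have d_le: "d s \<le> m * exp (\<kappa> * s)" if "s \<in> {0..T}" for s
  proof -
    have "d s * exp (- (\<kappa> * s)) \<le> m" unfolding m_def by (rule cSUP_upper[OF that bdd])
    then show ?thesis by (simp add: exp_minus field_simps)
  qed
  have m0: "0 \<le> m" using d_le[of 0] d[of 0] t by auto
  have main: "d r \<le> D0 + m / 2 * exp (\<kappa> * r)" if r: "0 < r" "r \<le> T" for r
  proof -
    define \<tau> where "\<tau> n s = mom (\<lambda>i. if n < i then \<bar>w i s - v i s\<bar> else 0)" for n s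
    have tail: "admissible (K + K) (\<lambda>i. if n < i then \<bar>w i s - v i s\<bar> else 0)" for n s
      by (rule admissible_mono[OF u]) auto
    have \<tau>_meas: "\<tau> n \<in> borel_measurable lebesgue" for n
    proof -
      have "(\<lambda>s. if n < i then \<bar>w i s - v i s\<bar> else 0) \<in> borel_measurable lebesgue" if "1 \<le> i" for i
        by (cases "n < i") (use traj_measurable[OF w that] traj_measurable[OF v that] in auto)
      then have "(\<lambda>s. mom (\<lambda>i. if n < i then \<bar>w i s - v i s\<bar> else 0)) \<in> borel_measurable lebesgue"
        by (rule borel_measurable_mom[OF _ tail])
      then show ?thesis unfolding \<tau>_def[abs_def] .
    qed
    have \<tau>_bd: "\<bar>\<tau> n s\<bar> \<le> K + K" for n s
      unfolding \<tau>_def using mom_le[OF tail] mom_nonneg[OF tail] by (simp add: abs_le_iff order_trans[OF _ mom_nonneg[OF tail]])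
    have \<tau>_int: "set_integrable lebesgue {0<..<r} (\<tau> n)" for n
      by (rule set_integrable_bounded_Ioo[OF \<tau>_meas \<tau>_bd])
    have \<tau>_lim: "(\<lambda>n. LINT s:{0<..<r}|lebesgue. \<tau> n s) \<longlonglongrightarrow> 0"
    proof -
      have "(\<lambda>n. LINT s|lebesgue. indicator {0<..<r} s *\<^sub>R \<tau> n s) \<longlonglongrightarrow> (LINT s::real|lebesgue. (0::real))"
      proof (rule integral_dominated_convergence[where w = "\<lambda>s. indicator {0<..<r} s *\<^sub>R (K + K)"])
        show "integrable lebesgue (\<lambda>s. indicator {0<..<r} s *\<^sub>R (K + K))"
          using set_integrable_bounded_Ioo[of "\<lambda>_. K + K" r "\<bar>K + K\<bar>"] by (simp add: set_integrable_def)
        show "AE s in lebesgue. (\<lambda>n. indicator {0<..<r} s *\<^sub>R \<tau> n s) \<longlonglongrightarrow> 0"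
        proof (intro AE_I2)
          fix s
          have "(\<lambda>n. \<tau> n s) \<longlonglongrightarrow> 0" unfolding \<tau>_def by (rule mom_tail_tendsto_0[OF u])
          then show "(\<lambda>n. indicator {0<..<r} s *\<^sub>R \<tau> n s) \<longlonglongrightarrow> 0" 
            using tendsto_scaleR[OF tendsto_const[of "indicator {0<..<r} s"]] by fastforce
        qed
        show "AE s in lebesgue. norm (indicator {0<..<r} s *\<^sub>R \<tau> n s) \<le> indicator {0<..<r} s *\<^sub>R (K + K)" for n
          using \<tau>_bd by (intro AE_I2) (auto simp: indicator_def)
        show "(\<lambda>s. indicator {0<..<r} s *\<^sub>R \<tau> n s) \<in> borel_measurable lebesgue" for n
          using \<tau>_int[of n] unfolding set_integrable_def by (rule borel_measurable_integrable)
      qed simp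
      then show ?thesis by (simp add: set_lebesgue_integral_def)
    qed
    have exp_int: "set_integrable lebesgue {0<..<r} (\<lambda>s. C * m * exp (\<kappa> * s))"
        "(LINT s:{0<..<r}|lebesgue. C * m * exp (\<kappa> * s)) = m / 2 * exp (\<kappa> * r) - m / 2 * exp (\<kappa> * 0)"
      by (rule set_integral_FTC_Ioo[where F = "\<lambda>s. m / 2 * exp (\<kappa> * s)"];
          use r C in \<open>auto intro!: derivative_eq_intros continuous_intros simp: \<kappa>_def\<close>)+
    have finite_bound: "(\<Sum>i=1..n. real i * \<bar>w i r - v i r\<bar>) \<le> D0 + m / 2 * exp (\<kappa> * r) + A * K * (LINT s:{0<..<r}|lebesgue. \<tau> n s)" for n
    proof -
      let ?db = "\<lambda>i s. diff_bound i (\<lambda>j. w j s) (\<lambda>j. v j s)"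
      have "(\<Sum>i=1..n. real i * \<bar>w i r - v i r\<bar>) \<le> (\<Sum>i=1..n. real i * (\<bar>w0 i - v0 i\<bar> + (LINT s:{0<..<r}|lebesgue. ?db i s)))"
        by (intro sum_mono mult_left_mono traj_abs_diff_le(1)[OF w v r]) auto
      also have "\<dots> = (\<Sum>i=1..n. real i * \<bar>w0 i - v0 i\<bar>) + (\<Sum>i=1..n. LINT s:{0<..<r}|lebesgue. real i * ?db i s)"
        by (simp add: distrib_left sum.distrib)
      also have "(\<Sum>i=1..n. LINT s:{0<..<r}|lebesgue. real i * ?db i s) = (LINT s:{0<..<r}|lebesgue. \<Sum>i=1..n. real i * ?db i s)"
        by (rule set_integral_sum[OF finite_atLeastAtMost, symmetric]) (auto intro!: set_integrable_mult_right traj_abs_diff_le(2)[OF w v r])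
      also have "\<dots> \<le> (LINT s:{0<..<r}|lebesgue. C * m * exp (\<kappa> * s) + A * K * \<tau> n s)"
      proof (rule set_integral_mono)
        show "set_integrable lebesgue {0<..<r} (\<lambda>s. \<Sum>i=1..n. real i * ?db i s)"
          by (rule set_integrable_sum[OF finite_atLeastAtMost]) (auto intro!: set_integrable_mult_right traj_abs_diff_le(2)[OF w v r])
        show "set_integrable lebesgue {0<..<r} (\<lambda>s. C * m * exp (\<kappa> * s) + A * K * \<tau> n s)"
          by (intro set_integral_add exp_int set_integrable_mult_right \<tau>_int)
        fix s assume s: "s \<in> {0<..<r}"
        have "(\<Sum>i=1..n. real i * ?db i s) \<le> 2 * A * K * d s + A * K * \<tau> n s"
          unfolding d_def \<tau>_def by (rule weighted_diff_bound_le[OF traj_adm[OF w] traj_adm[OF v]])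
        also have "2 * A * K * d s \<le> C * (m * exp (\<kappa> * s))"
          using C d d_le[of s] s r by (intro mult_mono) auto
        finally show "(\<Sum>i=1..n. real i * ?db i s) \<le> C * m * exp (\<kappa> * s) + A * K * \<tau> n s" by simp
      qed
      also have "\<dots> = m / 2 * exp (\<kappa> * r) - m / 2 + A * K * (LINT s:{0<..<r}|lebesgue. \<tau> n s)"
        by (subst set_integral_add) (use exp_int \<tau>_int in \<open>auto intro: set_integrable_mult_right\<close>)
      finally show ?thesis using D0[of n] m0 by linarith
    qed
    \<comment> \<open>The left side is frozen at N while n tends to infinity in the error, so the
      tail term is gone before N is released.\<close>
    have part: "(\<Sum>i=1..N. real i * \<bar>w i r - v i r\<bar>) \<le> D0 + m / 2 * exp (\<kappa> * r)" for N
    proof (rule LIMSEQ_le_const)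
      show "(\<lambda>n. D0 + m / 2 * exp (\<kappa> * r) + A * K * (LINT s:{0<..<r}|lebesgue. \<tau> n s)) \<longlonglongrightarrow> D0 + m / 2 * exp (\<kappa> * r)"
        using tendsto_add[OF tendsto_const[of "D0 + m / 2 * exp (\<kappa> * r)"] tendsto_mult[OF tendsto_const[of "A * K"] \<tau>_lim]] by simp
      have "(\<Sum>i=1..N. real i * \<bar>w i r - v i r\<bar>) \<le> (\<Sum>i=1..n. real i * \<bar>w i r - v i r\<bar>)" if "N \<le> n" for n
        by (rule sum_mono2) (use that in auto)
      then show "\<exists>M. \<forall>n\<ge>M. (\<Sum>i=1..N. real i * \<bar>w i r - v i r\<bar>) \<le> D0 + m / 2 * exp (\<kappa> * r) + A * K * (LINT s:{0<..<r}|lebesgue. \<tau> n s)"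
        using finite_bound by (meson order_trans)
    qed
    show ?thesis unfolding d_def mass_def by (rule infsum_partial_sums_le[OF _ part]) simp
  qed
  have D0_nonneg: "0 \<le> D0" using D0[of 0] by simp
  have d0: "d 0 \<le> D0"
    unfolding d_def mass_def
  proof (rule infsum_partial_sums_le)
    fix n
    have "(\<Sum>i=1..n. real i * \<bar>w i 0 - v i 0\<bar>) = (\<Sum>i=1..n. real i * \<bar>w0 i - v0 i\<bar>)"
      by (intro sum.cong) (use t traj_initial[OF w] traj_initial[OF v] in auto)
    then show "(\<Sum>i=1..n. real i * \<bar>w i 0 - v i 0\<bar>) \<le> D0" using D0[of n] by simp
  qed simp
  have "m \<le> D0 + m / 2"
    unfolding m_def
  proof (rule cSUP_least)
    show "{0..T} \<noteq> {}" using t by auto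
    fix r assume r: "r \<in> {0..T}"
    show "d r * exp (- (\<kappa> * r)) \<le> D0 + (SUP s\<in>{0..T}. d s * exp (- (\<kappa> * s))) / 2"
      unfolding m_def[symmetric]
    proof (cases "r = 0")
      case True
      then show "d r * exp (- (\<kappa> * r)) \<le> D0 + m / 2" using d0 m0 by simp
    next
      case False
      then have "d r * exp (- (\<kappa> * r)) \<le> (D0 + m / 2 * exp (\<kappa> * r)) * exp (- (\<kappa> * r))"
        using main[of r] r by (intro mult_right_mono) auto
      also have "\<dots> = D0 * exp (- (\<kappa> * r)) + m / 2" by (simp add: exp_minus field_simps)
      also have "D0 * exp (- (\<kappa> * r)) \<le> D0 * 1"
        using D0_nonneg C r by (intro mult_left_mono) (auto simp: \<kappa>_def)
      finally show "d r * exp (- (\<kappa> * r)) \<le> D0 + m / 2" by simp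
    qed
  qed
  then have "m \<le> 2 * D0" by linarith
  then have "m * exp (\<kappa> * t) \<le> 2 * D0 * exp (\<kappa> * t)" by (rule mult_right_mono) simp
  moreover have "d t \<le> m * exp (\<kappa> * t)" by (rule d_le) (use t in auto)
  ultimately show ?thesis unfolding d_def \<kappa>_def C_def by (rule order_trans[rotated])
qed

subsection \<open>Finitely supported initial data\<close>

definition trunc_rate :: "nat \<Rightarrow> nat \<Rightarrow> (nat \<Rightarrow> real) \<Rightarrow> real" where
  "trunc_rate N i y = (\<Sum>j=1..N. \<Sum>k=1..N. coef i j k * y j * y k)"

lemma rate_eq_trunc_rate:
  assumes "\<And>i. N < i \<Longrightarrow> y i = 0"
  shows "rate i y = trunc_rate N i y"
proof -
  have "rate i y = (\<Sum>\<^sub>\<infinity>(j, k)\<in>{1..N} \<times> {1..N}. coef i j k * y j * y k)"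
    unfolding rate_def using assms by (intro infsum_cong_neutral) (auto, (meson not_le)+)
  then show ?thesis by (simp add: trunc_rate_def sum.cartesian_product)
qed

text \<open>
  The values of a bounded continuous function at \<open>1, \<dots>, N\<close> are the unknowns of the system: the
  right-hand side is interpolated linearly, which embeds $\mathbb{R}^N$ for every \<open>N\<close> into one
  Banach space.
\<close>

lemma ex_clipped_solution:
  assumes R: "0 \<le> R"
  shows "\<exists>X. \<forall>i\<in>{1..N}. X i 0 = x0 i \<and>
    (\<forall>t\<ge>0. (X i has_real_derivative trunc_rate N i (\<lambda>j. clip R (X j t))) (at t within {0..}))"
proof -
  define e :: "nat \<Rightarrow> real \<Rightarrow>\<^sub>C real" where "e i = Bcontfun (\<lambda>t. max 0 (1 - \<bar>t - real i\<bar>))" for i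
  have e: "apply_bcontfun (e i) t = max 0 (1 - \<bar>t - real i\<bar>)" for i t
  proof -
    have "(\<lambda>t. max 0 (1 - \<bar>t - real i\<bar>)) \<in> bcontfun"
      by (rule bcontfun_normI[where b = 1]) (auto intro!: continuous_intros)
    then show ?thesis by (simp add: e_def Bcontfun_inverse)
  qed
  have norm_e: "norm (e i) \<le> 1" for i
    by (rule norm_bound) (auto simp: e)
  have e_nodes: "apply_bcontfun (e i) (real j) = (if i = j then 1 else 0)" for i j
    by (cases i j rule: linorder_cases) (auto simp: e)
  have apply_sum: "apply_bcontfun (\<Sum>i=1..N. c i *\<^sub>R e i) (real j) = c j" if "j \<in> {1..N}" for c j
  proof -
    interpret bounded_linear "\<lambda>f :: real \<Rightarrow>\<^sub>C real. apply_bcontfun f (real j)"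
      by (rule bounded_linear_apply_bcontfun)
    have "apply_bcontfun (\<Sum>i=1..N. c i *\<^sub>R e i) (real j) = (\<Sum>i=1..N. c i * (if i = j then 1 else 0))"
      by (simp add: sum e_nodes)
    also have "\<dots> = c j" using that by (simp add: if_distrib cong: if_cong)
    finally show ?thesis .
  qed
  define G where "G x i = trunc_rate N i (\<lambda>j. clip R (apply_bcontfun x (real j)))" for x :: "real \<Rightarrow>\<^sub>C real" and i
  define F where "F x = (\<Sum>i=1..N. G x i *\<^sub>R e i)" for x
  define L0 where "L0 i = (\<Sum>j=1..N. \<Sum>k=1..N. \<bar>coef i j k\<bar> * (2 * R))" for i
  have L0: "0 \<le> L0 i" for i unfolding L0_def using R by (intro sum_nonneg) auto
  have G_diff: "\<bar>G x i - G y i\<bar> \<le> L0 i * norm (x - y)" for x y i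
  proof -
    let ?x = "\<lambda>j. clip R (apply_bcontfun x (real j))" and ?y = "\<lambda>j. clip R (apply_bcontfun y (real j))"
    have "G x i - G y i = (\<Sum>j=1..N. \<Sum>k=1..N. coef i j k * (?x j * ?x k - ?y j * ?y k))"
      by (simp add: G_def trunc_rate_def algebra_simps flip: sum_subtractf)
    then have "\<bar>G x i - G y i\<bar> \<le> (\<Sum>j=1..N. \<Sum>k=1..N. \<bar>coef i j k * (?x j * ?x k - ?y j * ?y k)\<bar>)"
      by (simp only:) (intro order_trans[OF sum_abs] sum_mono order_refl)
    also have "\<dots> \<le> (\<Sum>j=1..N. \<Sum>k=1..N. \<bar>coef i j k\<bar> * (2 * R) * norm (x - y))"
    proof (intro sum_mono)
      fix j k
      have "\<bar>apply_bcontfun x l - apply_bcontfun y l\<bar> \<le> norm (x - y)" for l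
        using norm_bounded[of "x - y" l] by simp
      then have "\<bar>?x j * ?x k - ?y j * ?y k\<bar> \<le> 2 * R * norm (x - y)"
        by (intro clip_prod_diff[OF R])
      then show "\<bar>coef i j k * (?x j * ?x k - ?y j * ?y k)\<bar> \<le> \<bar>coef i j k\<bar> * (2 * R) * norm (x - y)"
        unfolding abs_mult mult.assoc by (intro mult_left_mono) auto
    qed
    also have "\<dots> = L0 i * norm (x - y)" unfolding L0_def sum_distrib_right ..
    finally show ?thesis .
  qed
  \<comment> \<open>The summand 1 makes the Lipschitz constant strictly positive even if all the
    coefficients vanish.\<close>
  define L where "L = (\<Sum>i=1..N. L0 i) + 1"
  have L: "0 < L" unfolding L_def using L0 by (intro add_nonneg_pos sum_nonneg) auto
  have lip: "norm (F x - F y) \<le> L * norm (x - y)" for x y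
  proof -
    have "F x - F y = (\<Sum>i=1..N. (G x i - G y i) *\<^sub>R e i)"
      by (simp add: F_def scaleR_diff_left sum_subtractf)
    then have "norm (F x - F y) \<le> (\<Sum>i=1..N. norm ((G x i - G y i) *\<^sub>R e i))"
      by (simp only: norm_sum)
    also have "\<dots> \<le> (\<Sum>i=1..N. L0 i * norm (x - y))"
    proof (rule sum_mono)
      fix i
      have "norm ((G x i - G y i) *\<^sub>R e i) \<le> \<bar>G x i - G y i\<bar> * 1"
        unfolding norm_scaleR by (intro mult_left_mono norm_e) simp
      also have "\<dots> \<le> L0 i * norm (x - y)" using G_diff by simp
      finally show "norm ((G x i - G y i) *\<^sub>R e i) \<le> L0 i * norm (x - y)" .
    qed
    also have "\<dots> \<le> L * norm (x - y)"
      unfolding L_def sum_distrib_right[symmetric] by (intro mult_right_mono) auto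
    finally show ?thesis .
  qed
  obtain x where x: "x 0 = (\<Sum>i=1..N. x0 i *\<^sub>R e i)"
      "\<And>t. t \<ge> 0 \<Longrightarrow> (x has_vector_derivative F (x t)) (at t within {0..})"
    using ex_global_solution_lipschitz[OF L lip] by blast
  show ?thesis
  proof (intro exI[of _ "\<lambda>i t. apply_bcontfun (x t) (real i)"] ballI conjI allI impI)
    fix i t assume i: "i \<in> {1..N}"
    show "apply_bcontfun (x 0) (real i) = x0 i" unfolding x(1) by (rule apply_sum[OF i])
    assume "0 \<le> (t::real)"
    from bounded_linear.has_vector_derivative[OF bounded_linear_apply_bcontfun x(2)[OF this]]
    have "((\<lambda>t. apply_bcontfun (x t) (real i)) has_vector_derivative apply_bcontfun (F (x t)) (real i)) (at t within {0..})" .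
    then show "((\<lambda>t. apply_bcontfun (x t) (real i)) has_real_derivative
        trunc_rate N i (\<lambda>j. clip R (apply_bcontfun (x t) (real j)))) (at t within {0..})"
      unfolding has_real_derivative_iff_has_vector_derivative F_def apply_sum[OF i] G_def .
  qed
qed

section \<open>Positivity and decay of moments for the finite system\<close>

lemma trunc_rate_nonneg:
  assumes i: "1 \<le> i" and y: "\<And>j. 0 \<le> y j" and "y i = 0"
  shows "0 \<le> trunc_rate N i y"
  unfolding trunc_rate_def
proof (intro sum_nonneg)
  fix j k assume "j \<in> {1..N}" "k \<in> {1..N}"
  \<comment> \<open>Quasi-positivity: only the row j = i has negative coefficients, and it carries
    the factor \<open>y i\<close>, which is 0.\<close>
  then show "0 \<le> coef i j k * y j * y k"
    using frag_nonneg[OF i, of k j] a_nonneg[of j k] y \<open>y i = 0\<close> by (cases "j = i") (auto simp: coef_def)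
qed

text \<open>
  Collisions only break clusters up, so every weight \<open>i * \<phi> i\<close> with \<open>\<phi>\<close> nondecreasing decreases.
\<close>

lemma weighted_trunc_rate_nonpos:
  fixes \<phi> :: "nat \<Rightarrow> real"
  assumes y: "\<And>j. 0 \<le> y j" and \<phi>: "\<And>i. 0 \<le> \<phi> i" "\<And>i j. 1 \<le> i \<Longrightarrow> i \<le> j \<Longrightarrow> \<phi> i \<le> \<phi> j"
  shows "(\<Sum>i=1..N. real i * \<phi> i * trunc_rate N i y) \<le> 0"
proof -
  have "(\<Sum>i=1..N. real i * \<phi> i * trunc_rate N i y)
      = (\<Sum>i=1..N. \<Sum>j=1..N. \<Sum>k=1..N. real i * \<phi> i * (coef i j k * y j * y k))"
    by (simp add: trunc_rate_def sum_distrib_left)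
  also have "\<dots> = (\<Sum>j=1..N. \<Sum>i=1..N. \<Sum>k=1..N. real i * \<phi> i * (coef i j k * y j * y k))"
    by (rule sum.swap)
  also have "\<dots> = (\<Sum>j=1..N. \<Sum>k=1..N. \<Sum>i=1..N. real i * \<phi> i * (coef i j k * y j * y k))"
    by (intro sum.cong refl sum.swap)
  also have "\<dots> \<le> (\<Sum>j=1..N. \<Sum>k=1..N. 0)"
  proof (intro sum_mono)
    fix j k assume j: "j \<in> {1..N}" and k: "k \<in> {1..N}"
    have "(\<Sum>i=1..N. real i * \<phi> i * frag i j k) \<le> (\<Sum>i=1..N. \<phi> j * (real i * frag i j k))"
    proof (rule sum_mono)
      fix i assume i: "i \<in> {1..N}"
      show "real i * \<phi> i * frag i j k \<le> \<phi> j * (real i * frag i j k)"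
      proof (cases "i < j")
        case True
        then have "\<phi> i * (real i * frag i j k) \<le> \<phi> j * (real i * frag i j k)"
          using i k \<phi>(2)[of i j] frag_nonneg[of i k j] by (intro mult_right_mono) auto
        then show ?thesis by (simp add: mult_ac)
      qed (simp add: frag_def)
    qed
    also have "\<dots> \<le> \<phi> j * real j"
      using sum_frag_le[of k j N] k \<phi>(1)[of j] by (auto simp flip: sum_distrib_left intro: mult_left_mono)
    finally have le: "(\<Sum>i=1..N. real i * \<phi> i * frag i j k) - real j * \<phi> j \<le> 0" by (simp add: mult.commute)
    have "(\<Sum>i=1..N. real i * \<phi> i * (coef i j k * y j * y k))
        = (\<Sum>i=1..N. (real i * \<phi> i * frag i j k - (if i = j then real i * \<phi> i else 0)) * (a j k * y j * y k))"
      by (intro sum.cong) (auto simp: coef_def algebra_simps)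
    also have "\<dots> = ((\<Sum>i=1..N. real i * \<phi> i * frag i j k) - real j * \<phi> j) * (a j k * y j * y k)"
      using j by (simp add: sum_subtractf flip: sum_distrib_right)
    also have "\<dots> \<le> 0"
      using le a_nonneg[of j k] y j k by (intro mult_nonpos_nonneg) auto
    finally show "(\<Sum>i=1..N. real i * \<phi> i * (coef i j k * y j * y k)) \<le> 0" .
  qed
  finally show ?thesis by simp
qed

text \<open>After the last time \<open>Sup S\<close> at which X_i is nonnegative, its clipped value
  is 0, so no loss is left and X_i cannot decrease. Each component is treated alone, because
  clipping makes the other arguments nonnegative whatever their sign. No perturbation to strict
  inequalities is needed.\<close>

lemma clipped_solution_nonneg:
  assumes R: "0 \<le> R"
    and X: "\<And>i t. i \<in> {1..N} \<Longrightarrow> 0 \<le> t \<Longrightarrow>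
      (X i has_real_derivative trunc_rate N i (\<lambda>j. clip R (X j t))) (at t within {0..})"
    and init: "\<And>i. i \<in> {1..N} \<Longrightarrow> 0 \<le> X i 0"
    and i: "i \<in> {1..N}" and t: "0 \<le> t"
  shows "0 \<le> X i t"
proof (rule ccontr)
  assume neg: "\<not> 0 \<le> X i t"
  have cont: "continuous_on {0..t} (X i)"
    by (rule continuous_on_subset[of "{0..}"]) (use DERIV_continuous_on[OF X[OF i]] in auto)
  define S where "S = {s\<in>{0..t}. 0 \<le> X i s}"
  have "S = {0..t} \<inter> X i -` {0..}" by (auto simp: S_def)
  then have "closed S"
    using continuous_closed_preimage[OF cont closed_atLeastAtMost closed_atLeast, of 0] by simp
  moreover have "0 \<in> S" using t init[OF i] by (simp add: S_def)
  moreover have "bdd_above S" by (auto simp: S_def intro!: bdd_aboveI[of _ t])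
  ultimately have s: "Sup S \<in> S" using closed_contains_Sup[of S] by auto
  have after: "X i r < 0" if "Sup S < r" "r \<le> t" for r
  proof (rule ccontr)
    assume "\<not> X i r < 0"
    then have "r \<in> S" using that s by (auto simp: S_def)
    then have "r \<le> Sup S" by (rule cSup_upper) fact
    then show False using that by simp
  qed
  have "X i (Sup S) \<le> X i t"
  proof (rule DERIV_nonneg_imp_increasing_open[where f = "X i"])
    show "Sup S \<le> t" "continuous_on {Sup S..t} (X i)"
      using s continuous_on_subset[OF cont] by (auto simp: S_def)
    fix r assume r: "Sup S < r" "r < t"
    then have "0 < r" using s by (auto simp: S_def)
    then have "at r within {0..} = at r" by (intro at_within_interior) simp
    then have "DERIV (X i) r :> trunc_rate N i (\<lambda>j. clip R (X j r))" using X[OF i, of r] \<open>0 < r\<close> by simp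
    moreover have "0 \<le> trunc_rate N i (\<lambda>j. clip R (X j r))"
      by (rule trunc_rate_nonneg) (use i clip_bounds[OF R] clip_neg after[of r] r in auto)
    ultimately show "\<exists>y. DERIV (X i) r :> y \<and> 0 \<le> y" by blast
  qed
  then show False using s neg by (auto simp: S_def)
qed

text \<open>The sign of the weighted rate requires only nonnegative arguments, hence it holds for
  the clipped system itself. This avoids a circle: the bound is available before the clipping is
  known to be inactive.\<close>

lemma clipped_solution_weighted_le:
  fixes \<phi> :: "nat \<Rightarrow> real"
  assumes R: "0 \<le> R"
    and X: "\<And>i t. i \<in> {1..N} \<Longrightarrow> 0 \<le> t \<Longrightarrow>
      (X i has_real_derivative trunc_rate N i (\<lambda>j. clip R (X j t))) (at t within {0..})"
    and \<phi>: "\<And>i. 0 \<le> \<phi> i" "\<And>i j. 1 \<le> i \<Longrightarrow> i \<le> j \<Longrightarrow> \<phi> i \<le> \<phi> j"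
    and t: "0 \<le> t"
  shows "(\<Sum>i=1..N. real i * \<phi> i * X i t) \<le> (\<Sum>i=1..N. real i * \<phi> i * X i 0)"
proof (rule DERIV_nonpos_imp_decreasing_open[where f = "\<lambda>t. \<Sum>i=1..N. real i * \<phi> i * X i t", OF t])
  have "continuous_on {0..t} (X i)" if "i \<in> {1..N}" for i
    by (rule continuous_on_subset[of "{0..}"]) (use DERIV_continuous_on[OF X[OF that]] in auto)
  then show "continuous_on {0..t} (\<lambda>t. \<Sum>i=1..N. real i * \<phi> i * X i t)"
    by (intro continuous_on_sum continuous_on_mult_left)
  fix r assume r: "0 < r" "r < t"
  then have "at r within {0..} = at r" by (intro at_within_interior) simp
  then have "DERIV (\<lambda>t. \<Sum>i=1..N. real i * \<phi> i * X i t) r :> (\<Sum>i=1..N. real i * \<phi> i * trunc_rate N i (\<lambda>j. clip R (X j r)))"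
    using X r by (intro DERIV_sum DERIV_cmult) (metis less_imp_le)
  then show "\<exists>y. DERIV (\<lambda>t. \<Sum>i=1..N. real i * \<phi> i * X i t) r :> y \<and> y \<le> 0"
    using weighted_trunc_rate_nonpos[of "\<lambda>j. clip R (X j r)" \<phi> N, OF clip_bounds(1)[OF R] \<phi>] by blast
qed

text \<open>The last conjunct bounds the tails at all times by those of the initial data, which is
  what survives as N grows; its case n = 0 is admissibility. The middle one fixes the path at
  negative times, so that limits can be taken on the whole line.\<close>

lemma ex_truncated_traj:
  assumes x0: "admissible K x0"
  shows "\<exists>w. (\<forall>T. traj K T (\<lambda>i. if i \<le> N then x0 i else 0) w) \<and> (\<forall>i t. w i t = w i (max 0 t)) \<and>
    (\<forall>n m t. (\<Sum>i=1..m. real i powr (1 + \<gamma>) * (if n < i then w i t else 0))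
      \<le> (\<Sum>i=1..N. real i powr (1 + \<gamma>) * (if n < i then x0 i else 0)))"
proof -
  \<comment> \<open>R is the mass of the truncated datum. Since i \<ge> 1, every component is at
    most the total mass, which does not increase, so clipping at R is never felt.\<close>
  define R where "R = (\<Sum>i=1..N. real i * x0 i)"
  have x0_nonneg: "0 \<le> x0 i" if "1 \<le> i" for i using admissible_nonneg[OF x0 that] .
  have R: "0 \<le> R" unfolding R_def by (intro sum_nonneg mult_nonneg_nonneg) (auto simp: x0_nonneg)
  obtain X where X: "\<And>i. i \<in> {1..N} \<Longrightarrow> X i 0 = x0 i"
     "\<And>i t. i \<in> {1..N} \<Longrightarrow> 0 \<le> t \<Longrightarrow>
      (X i has_real_derivative trunc_rate N i (\<lambda>j. clip R (X j t))) (at t within {0..})"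
    using ex_clipped_solution[OF R, of N x0] by blast
  have X_nonneg: "0 \<le> X i t" if "i \<in> {1..N}" "0 \<le> t" for i t
    by (rule clipped_solution_nonneg[OF R X(2)]) (use that X(1) x0_nonneg in auto)
  have weighted: "(\<Sum>i=1..N. real i * \<phi> i * X i t) \<le> (\<Sum>i=1..N. real i * \<phi> i * x0 i)"
    if "\<And>i. 0 \<le> \<phi> i" "\<And>i j. 1 \<le> i \<Longrightarrow> i \<le> j \<Longrightarrow> \<phi> i \<le> \<phi> j" "0 \<le> t" for \<phi> :: "nat \<Rightarrow> real" and t
    using clipped_solution_weighted_le[OF R X(2) that] X(1) by simp
  have X_le: "X i t \<le> R" if i: "i \<in> {1..N}" and t: "0 \<le> t" for i t
  proof -
    have "X i t \<le> real i * X i t" using X_nonneg[OF i t] i by (simp add: mult_le_cancel_right1)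
    also have "\<dots> \<le> (\<Sum>i=1..N. real i * X i t)"
      by (rule member_le_sum) (use i t X_nonneg in auto)
    also have "\<dots> \<le> R" using weighted[of "\<lambda>_. 1" t] t by (simp add: R_def)
    finally show ?thesis .
  qed
  define w where "w i t = (if i \<in> {1..N} then X i (max 0 t) else 0)" for i t
  have w_nonneg: "0 \<le> w i t" for i t by (auto simp: w_def X_nonneg)
  have tail: "(\<Sum>i=1..m. real i powr (1 + \<gamma>) * (if n < i then w i t else 0))
      \<le> (\<Sum>i=1..N. real i powr (1 + \<gamma>) * (if n < i then x0 i else 0))" for n m t
  proof -
    \<comment> \<open>This weight vanishes up to n and is i^\<gamma> beyond, hence nondecreasing;
      multiplied by i it gives the tail of the moment of order 1 + \<gamma>.\<close>
    define \<phi> where "\<phi> i = (if n < i then real i powr \<gamma> else 0)" for i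
    have \<phi>: "real i * \<phi> i * c = real i powr (1 + \<gamma>) * (if n < i then c else 0)" if "i \<in> {1..N}" for i c
      using that by (auto simp: \<phi>_def powr_add)
    have "(\<Sum>i=1..m. real i powr (1 + \<gamma>) * (if n < i then w i t else 0))
        \<le> (\<Sum>i=1..max m N. real i powr (1 + \<gamma>) * (if n < i then w i t else 0))"
      by (rule sum_mono2) (auto simp: w_nonneg)
    also have "\<dots> = (\<Sum>i=1..N. real i powr (1 + \<gamma>) * (if n < i then w i t else 0))"
      by (rule sum.mono_neutral_right) (auto simp: w_def)
    also have "\<dots> = (\<Sum>i=1..N. real i * \<phi> i * X i (max 0 t))"
      by (intro sum.cong) (use \<phi> in \<open>auto simp: w_def\<close>)
    also have "\<dots> \<le> (\<Sum>i=1..N. real i * \<phi> i * x0 i)"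
      by (rule weighted) (use gamma in \<open>auto simp: \<phi>_def intro: powr_mono2\<close>)
    also have "\<dots> = (\<Sum>i=1..N. real i powr (1 + \<gamma>) * (if n < i then x0 i else 0))"
      by (intro sum.cong) (use \<phi> in auto)
    finally show ?thesis .
  qed
  have admissible_w: "admissible K (\<lambda>i. w i t)" for t
    unfolding admissible_def
  proof (intro conjI allI impI)
    fix n
    have "(\<Sum>i=1..n. real i powr (1 + \<gamma>) * w i t) = (\<Sum>i=1..n. real i powr (1 + \<gamma>) * (if 0 < i then w i t else 0))"
      by (intro sum.cong) auto
    also have "\<dots> \<le> (\<Sum>i=1..N. real i powr (1 + \<gamma>) * (if 0 < i then x0 i else 0))" by (rule tail)
    also have "\<dots> = (\<Sum>i=1..N. real i powr (1 + \<gamma>) * x0 i)" by (intro sum.cong) auto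
    also have "\<dots> \<le> K" using x0 by (simp add: admissible_def)
    finally show "(\<Sum>i=1..n. real i powr (1 + \<gamma>) * w i t) \<le> K" .
  qed (rule w_nonneg)
  have rate_w: "rate i (\<lambda>j. w j t) = trunc_rate N i (\<lambda>j. w j t)" for i t
    by (rule rate_eq_trunc_rate) (auto simp: w_def)
  have rate_clip: "trunc_rate N i (\<lambda>j. clip R (X j t)) = rate i (\<lambda>j. w j t)" if "0 \<le> t" for i t
    unfolding rate_w unfolding trunc_rate_def
    by (intro sum.cong) (use that X_nonneg X_le in \<open>auto simp: w_def clip_id\<close>)
  have cont_w: "continuous_on UNIV (w i)" for i
  proof (cases "i \<in> {1..N}")
    case True
    have "continuous_on {0..} (X i)" using DERIV_continuous_on[OF X(2)[OF True]] by auto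
    then have "continuous_on UNIV (\<lambda>t. X i (max 0 t))"
      by (rule continuous_on_compose2) (auto intro!: continuous_intros)
    then show ?thesis using True by (simp add: w_def[abs_def])
  next
    case False
    then have "w i = (\<lambda>_. 0)" by (auto simp: w_def)
    then show ?thesis by simp
  qed
  have cont_rate: "continuous_on S (\<lambda>s. rate i (\<lambda>j. w j s))" for S i
    unfolding rate_w trunc_rate_def
    by (intro continuous_intros continuous_on_subset[OF cont_w]) auto
  have eq: "w i t = (if i \<le> N then x0 i else 0) + (LINT s:{0<..<t}|lebesgue. rate i (\<lambda>j. w j s))"
    if i: "1 \<le> i" and t: "0 \<le> t" for i t
  proof (cases "i \<le> N")
    case True
    have "(w i has_real_derivative rate i (\<lambda>j. w j s)) (at s within {0..t})" if s: "s \<in> {0..t}" for s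
    proof (rule has_field_derivative_transform_within[where f = "X i", OF _ zero_less_one])
      have "(X i has_real_derivative trunc_rate N i (\<lambda>j. clip R (X j s))) (at s within {0..})"
        using X(2)[of i s] True i s by auto
      then have "(X i has_real_derivative trunc_rate N i (\<lambda>j. clip R (X j s))) (at s within {0..t})"
        by (rule has_field_derivative_subset) auto
      then show "(X i has_real_derivative rate i (\<lambda>j. w j s)) (at s within {0..t})"
        using rate_clip[of s i] s by simp
    qed (use s True i in \<open>auto simp: w_def\<close>)
    from set_integral_FTC_Ioo(2)[OF t this cont_rate]
    show ?thesis using True i X(1)[of i] by (simp add: w_def)
  next
    case False
    \<comment> \<open>Here i > N, while only sizes j \<le> N are present: such a cluster neither
      breaks into fragments of size i nor is itself of size i.\<close>
    have "rate i (\<lambda>j. w j s) = 0" for s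
      unfolding rate_w trunc_rate_def
      by (intro sum.neutral ballI) (use False in \<open>auto simp: coef_def frag_def\<close>)
    then show ?thesis using False by (simp add: w_def)
  qed
  have "traj K T (\<lambda>i. if i \<le> N then x0 i else 0) w" for T
    unfolding traj_def using cont_w admissible_w eq by auto
  moreover have "w i t = w i (max 0 t)" for i t by (simp add: w_def)
  ultimately show ?thesis using tail by blast
qed

subsection \<open>Existence for general initial data\<close>

lemma mom_le_truncated:
  assumes u: "admissible K u" and tail: "\<And>m. (\<Sum>i=1..m. real i powr (1 + \<gamma>) * (if n < i then u i else 0)) \<le> \<epsilon>"
  shows "mom u \<le> (\<Sum>i=1..n. real i powr (1 + \<gamma>) * u i) + \<epsilon>"
  unfolding mom_def
proof (rule infsum_partial_sums_le)
  fix m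
  have "(\<Sum>i=1..m. real i powr (1 + \<gamma>) * u i)
      = (\<Sum>i=1..m. (if i \<le> n then real i powr (1 + \<gamma>) * u i else 0)) + (\<Sum>i=1..m. real i powr (1 + \<gamma>) * (if n < i then u i else 0))"
    unfolding sum.distrib[symmetric] by (intro sum.cong) auto
  also have "(\<Sum>i=1..m. (if i \<le> n then real i powr (1 + \<gamma>) * u i else 0)) = (\<Sum>i\<in>{1..m} \<inter> {..n}. real i powr (1 + \<gamma>) * u i)"
    by (subst sum.inter_restrict) (auto intro: sum.cong)
  also have "\<dots> \<le> (\<Sum>i=1..n. real i powr (1 + \<gamma>) * u i)"
    by (rule sum_mono2) (use admissible_nonneg[OF u] in auto)
  finally show "(\<Sum>i=1..m. real i powr (1 + \<gamma>) * u i) \<le> (\<Sum>i=1..n. real i powr (1 + \<gamma>) * u i) + \<epsilon>"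
    using tail[of m] by linarith
qed (use admissible_nonneg[OF u] in auto)

text \<open>Stability makes the approximations Cauchy componentwise with an explicit rate, which
  gives continuity of the limit. Convergence of the rates needs the moment of order 1 + \<gamma>; it
  follows from componentwise convergence of finitely many terms together with tail bounds common to
  all N.\<close>

lemma ex_traj:
  assumes x0: "admissible K x0"
  shows "\<exists>w. \<forall>T. traj K T x0 w"
proof -
  from ex_truncated_traj[OF x0]
  have "\<forall>N. \<exists>w. (\<forall>T. traj K T (\<lambda>i. if i \<le> N then x0 i else 0) w) \<and> (\<forall>i t. w i t = w i (max 0 t)) \<and>
    (\<forall>n m t. (\<Sum>i=1..m. real i powr (1 + \<gamma>) * (if n < i then w i t else 0))
      \<le> (\<Sum>i=1..N. real i powr (1 + \<gamma>) * (if n < i then x0 i else 0)))"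
    by (intro allI)
  from choice[OF this] obtain W where
      W_all: "\<forall>N. (\<forall>T. traj K T (\<lambda>i. if i \<le> N then x0 i else 0) (W N)) \<and> (\<forall>i t. W N i t = W N i (max 0 t)) \<and>
    (\<forall>n m t. (\<Sum>i=1..m. real i powr (1 + \<gamma>) * (if n < i then W N i t else 0))
      \<le> (\<Sum>i=1..N. real i powr (1 + \<gamma>) * (if n < i then x0 i else 0)))" ..
  have W: "traj K T (\<lambda>i. if i \<le> N then x0 i else 0) (W N)" for N T
    using W_all by simp
  have W_max: "W N i t = W N i (max 0 t)" for N i t
    using W_all by blast
  have W_tail: "(\<Sum>i=1..m. real i powr (1 + \<gamma>) * (if n < i then W N i t else 0))
      \<le> (\<Sum>i=1..N. real i powr (1 + \<gamma>) * (if n < i then x0 i else 0))" for N n m t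
    using W_all by blast
  \<comment> \<open>The tail of the initial datum has two uses: it bounds the Y_1 distance between
    truncated data, and it bounds the tails of every \<open>W N\<close> at every time.\<close>
  define \<epsilon> where "\<epsilon> n = mom (\<lambda>i. if n < i then x0 i else 0)" for n
  have x0_tail: "admissible K (\<lambda>i. if n < i then x0 i else 0)" for n
    by (rule admissible_mono[OF x0]) (auto simp: admissible_nonneg[OF x0])
  have \<epsilon>_nonneg: "0 \<le> \<epsilon> n" for n unfolding \<epsilon>_def by (rule mom_nonneg[OF x0_tail])
  have \<epsilon>_lim: "\<epsilon> \<longlonglongrightarrow> 0" using mom_tail_tendsto_0[OF x0] by (simp add: \<epsilon>_def[abs_def])
  have x0_tail_le: "(\<Sum>i=1..m. real i powr (1 + \<gamma>) * (if n < i then x0 i else 0)) \<le> \<epsilon> n" for n m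
    unfolding \<epsilon>_def mom_def
    by (rule sum_le_infsum_atLeast1[OF admissible_summable[OF x0_tail]]) (auto simp: admissible_nonneg[OF x0])
  define c where "c = 2 * (2 * A * K + 1)"
  have c: "0 \<le> c" using A_pos admissible_K_nonneg[OF x0] by (simp add: c_def)
  have W_diff: "\<bar>W N i t - W M i t\<bar> \<le> 2 * \<epsilon> N * exp (c * max 0 t)" if NM: "N \<le> M" and i: "1 \<le> i" for N M i t
  proof -
    define u where "u i = \<bar>W N i (max 0 t) - W M i (max 0 t)\<bar>" for i
    have u: "admissible (K + K) u" unfolding u_def[abs_def] by (rule admissible_abs_diff[OF traj_adm[OF W] traj_adm[OF W]])
    have "mass u \<le> 2 * \<epsilon> N * exp (2 * (2 * A * K + 1) * max 0 t)"
      unfolding u_def[abs_def]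
    proof (rule traj_stability[where T = "max 0 t", OF W W])
      fix n
      have "(\<Sum>i=1..n. real i * \<bar>(if i \<le> N then x0 i else 0) - (if i \<le> M then x0 i else 0)\<bar>)
          \<le> (\<Sum>i=1..n. real i powr (1 + \<gamma>) * (if N < i then x0 i else 0))"
      proof (intro sum_mono mult_mono)
        fix i assume "i \<in> {1..n}"
        then show "\<bar>(if i \<le> N then x0 i else 0) - (if i \<le> M then x0 i else 0)\<bar> \<le> (if N < i then x0 i else 0)"
          using NM admissible_nonneg[OF x0, of i] by auto
      qed (auto intro: real_le_powr)
      also have "\<dots> \<le> \<epsilon> N" by (rule x0_tail_le)
      finally show "(\<Sum>i=1..n. real i * \<bar>(if i \<le> N then x0 i else 0) - (if i \<le> M then x0 i else 0)\<bar>) \<le> \<epsilon> N" .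
    qed auto
    moreover have "u i \<le> mass u"
    proof -
      have "u i \<le> real i * u i" using i admissible_nonneg[OF u i] by (simp add: mult_le_cancel_right1)
      also have "\<dots> \<le> (\<Sum>i=1..i. real i * u i)"
        by (rule member_le_sum) (use i admissible_nonneg[OF u] in auto)
      also have "\<dots> \<le> mass u" unfolding mass_def
        by (rule sum_le_infsum_atLeast1[OF admissible_summable1[OF u]]) (use admissible_nonneg[OF u] in auto)
      finally show ?thesis .
    qed
    ultimately show ?thesis using W_max[of N i t] W_max[of M i t] by (simp add: u_def c_def)
  qed
  have Cauchy: "Cauchy (\<lambda>N. W N i t)" if i: "1 \<le> i" for i t
  proof (rule metric_CauchyI)
    fix e :: real assume "0 < e"
    have "(\<lambda>N. 2 * \<epsilon> N * exp (c * max 0 t)) \<longlonglongrightarrow> 2 * 0 * exp (c * max 0 t)"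
      by (intro tendsto_intros \<epsilon>_lim)
    then have "\<forall>\<^sub>F N in sequentially. 2 * \<epsilon> N * exp (c * max 0 t) < e"
      using \<open>0 < e\<close> by (intro order_tendstoD(2)[where y = "2 * 0 * exp (c * max 0 t)"]) auto
    then obtain N0 where N0: "\<And>N. N \<ge> N0 \<Longrightarrow> 2 * \<epsilon> N * exp (c * max 0 t) < e"
      unfolding eventually_sequentially by blast
    have "dist (W N i t) (W M i t) < e" if "N0 \<le> N" "N0 \<le> M" for N M
    proof (cases "N \<le> M")
      case True
      then show ?thesis using W_diff[OF True i, of t] N0[OF that(1)] by (simp add: dist_real_def)
    next
      case False
      then show ?thesis using W_diff[of M N i t] i N0[OF that(2)] by (simp add: dist_real_def abs_minus_commute)
    qed
    then show "\<exists>N0. \<forall>N\<ge>N0. \<forall>M\<ge>N0. dist (W N i t) (W M i t) < e" by blast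
  qed
  define w where "w i t = lim (\<lambda>N. W N i t)" for i t
  have W_lim: "(\<lambda>N. W N i t) \<longlonglongrightarrow> w i t" if "1 \<le> i" for i t
    using Cauchy_convergent[OF Cauchy[OF that]] by (simp add: w_def convergent_LIMSEQ_iff)
  have w_diff: "\<bar>W N i t - w i t\<bar> \<le> 2 * \<epsilon> N * exp (c * max 0 t)" if i: "1 \<le> i" for N i t
  proof (rule LIMSEQ_le_const2)
    show "(\<lambda>M. \<bar>W N i t - W M i t\<bar>) \<longlonglongrightarrow> \<bar>W N i t - w i t\<bar>"
      by (intro tendsto_rabs tendsto_diff tendsto_const W_lim[OF i])
    show "\<exists>M0. \<forall>M\<ge>M0. \<bar>W N i t - W M i t\<bar> \<le> 2 * \<epsilon> N * exp (c * max 0 t)"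
      using W_diff i by blast
  qed
  have admissible_w: "admissible K (\<lambda>i. w i t)" for t
    unfolding admissible_def
  proof (intro conjI allI impI)
    show "0 \<le> w i t" if "1 \<le> i" for i
      by (rule LIMSEQ_le_const[OF W_lim[OF that]]) (use admissible_nonneg[OF traj_adm[OF W] that] in auto)
    fix n
    show "(\<Sum>i=1..n. real i powr (1 + \<gamma>) * w i t) \<le> K"
    proof (rule LIMSEQ_le_const2)
      show "(\<lambda>N. \<Sum>i=1..n. real i powr (1 + \<gamma>) * W N i t) \<longlonglongrightarrow> (\<Sum>i=1..n. real i powr (1 + \<gamma>) * w i t)"
        by (intro tendsto_sum tendsto_mult tendsto_const W_lim) auto
      show "\<exists>N. \<forall>M\<ge>N. (\<Sum>i=1..n. real i powr (1 + \<gamma>) * W M i t) \<le> K"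
        using traj_adm[OF W] by (auto simp: admissible_def)
    qed
  qed
  have W_tail': "(\<Sum>i=1..m. real i powr (1 + \<gamma>) * (if n < i then W N i t else 0)) \<le> \<epsilon> n" for N n m t
    using W_tail[where m=m and n=n and N=N and t=t] x0_tail_le[where n=n and m=N] by linarith
  have w_tail: "(\<Sum>i=1..m. real i powr (1 + \<gamma>) * (if n < i then w i t else 0)) \<le> \<epsilon> n" for n m t
  proof (rule LIMSEQ_le_const2)
    show "(\<lambda>N. \<Sum>i=1..m. real i powr (1 + \<gamma>) * (if n < i then W N i t else 0))
      \<longlonglongrightarrow> (\<Sum>i=1..m. real i powr (1 + \<gamma>) * (if n < i then w i t else 0))"
      by (intro tendsto_sum tendsto_mult tendsto_const) (auto intro: W_lim)
  qed (use W_tail' in blast)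
  have mom_lim: "(\<lambda>N. mom (\<lambda>i. \<bar>W N i t - w i t\<bar>)) \<longlonglongrightarrow> 0" for t
  proof (rule LIMSEQ_I)
    fix e :: real assume "0 < e"
    \<comment> \<open>Two tails occur, that of \<open>W N\<close> and that of \<open>w\<close>, each
      below e / 4; the remaining e / 2 is for the first n terms.\<close>
    then have "\<forall>\<^sub>F n in sequentially. \<epsilon> n < e / 4" using \<epsilon>_lim by (intro order_tendstoD) auto
    then obtain n where n: "\<epsilon> n < e / 4" by (auto simp: eventually_sequentially)
    have "(\<lambda>N. \<Sum>i=1..n. real i powr (1 + \<gamma>) * \<bar>W N i t - w i t\<bar>) \<longlonglongrightarrow> (\<Sum>i=1..n. real i powr (1 + \<gamma>) * \<bar>w i t - w i t\<bar>)"
      by (intro tendsto_sum tendsto_mult tendsto_const tendsto_rabs tendsto_diff W_lim) auto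
    then have "\<forall>\<^sub>F N in sequentially. (\<Sum>i=1..n. real i powr (1 + \<gamma>) * \<bar>W N i t - w i t\<bar>) < e / 2"
      using \<open>0 < e\<close> by (intro order_tendstoD) auto
    then obtain N0 where N0: "\<And>N. N \<ge> N0 \<Longrightarrow> (\<Sum>i=1..n. real i powr (1 + \<gamma>) * \<bar>W N i t - w i t\<bar>) < e / 2"
      unfolding eventually_sequentially by blast
    have "norm (mom (\<lambda>i. \<bar>W N i t - w i t\<bar>) - 0) < e" if "N \<ge> N0" for N
    proof -
      have u: "admissible (K + K) (\<lambda>i. \<bar>W N i t - w i t\<bar>)" by (rule admissible_abs_diff[OF traj_adm[OF W] admissible_w])
      have "mom (\<lambda>i. \<bar>W N i t - w i t\<bar>) \<le> (\<Sum>i=1..n. real i powr (1 + \<gamma>) * \<bar>W N i t - w i t\<bar>) + (\<epsilon> n + \<epsilon> n)"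
      proof (rule mom_le_truncated[OF u])
        fix m
        have "(\<Sum>i=1..m. real i powr (1 + \<gamma>) * (if n < i then \<bar>W N i t - w i t\<bar> else 0))
          \<le> (\<Sum>i=1..m. real i powr (1 + \<gamma>) * (if n < i then W N i t else 0) + real i powr (1 + \<gamma>) * (if n < i then w i t else 0))"
          unfolding distrib_left[symmetric]
          by (intro sum_mono mult_left_mono) (use admissible_nonneg[OF traj_adm[OF W]] admissible_nonneg[OF admissible_w] in \<open>auto simp: abs_le_iff\<close>)
        also have "\<dots> \<le> \<epsilon> n + \<epsilon> n" unfolding sum.distrib by (intro add_mono W_tail' w_tail)
        finally show "(\<Sum>i=1..m. real i powr (1 + \<gamma>) * (if n < i then \<bar>W N i t - w i t\<bar> else 0)) \<le> \<epsilon> n + \<epsilon> n" .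
      qed
      then show ?thesis using N0[OF that] n mom_nonneg[OF u] by simp
    qed
    then show "\<exists>N0. \<forall>N\<ge>N0. norm (mom (\<lambda>i. \<bar>W N i t - w i t\<bar>) - 0) < e" by blast
  qed
  have rate_lim: "(\<lambda>N. rate i (\<lambda>j. W N j t)) \<longlonglongrightarrow> rate i (\<lambda>j. w j t)" if i: "1 \<le> i" for i t
  proof (rule Lim_null[THEN iffD2], rule Lim_null_comparison)
    show "\<forall>\<^sub>F N in sequentially. norm (rate i (\<lambda>j. W N j t) - rate i (\<lambda>j. w j t)) \<le> 2 * A * K * mom (\<lambda>i. \<bar>W N i t - w i t\<bar>)"
      using abs_rate_diff_le[OF i traj_adm[OF W] admissible_w] by simp
    show "(\<lambda>N. 2 * A * K * mom (\<lambda>i. \<bar>W N i t - w i t\<bar>)) \<longlonglongrightarrow> 0"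
      using tendsto_mult[OF tendsto_const[of "2 * A * K"] mom_lim] by simp
  qed
  have cont_w: "continuous_on UNIV (w i)" if i: "1 \<le> i" for i
  proof -
    \<comment> \<open>The error bound depends on \<open>max 0 t\<close>, so it is uniform on a whole
      half-line; these half-lines are open, hence continuity on each of them gives continuity on
      their union.\<close>
    have "continuous_on {..<T} (w i)" for T
    proof (rule uniform_limit_theorem[where F = sequentially and f = "\<lambda>N. W N i"])
      have "continuous_on UNIV (W N i)" for N using W[of 0 N] i by (simp add: traj_def)
      then show "\<forall>\<^sub>F N in sequentially. continuous_on {..<T} (W N i)"
        by (intro always_eventually allI) (rule continuous_on_subset[OF _ subset_UNIV])
      show "uniform_limit {..<T} (\<lambda>N. W N i) (w i) sequentially"
      proof (rule uniform_limitI)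
        fix e :: real assume "0 < e"
        have "(\<lambda>N. 2 * \<epsilon> N * exp (c * max 0 T)) \<longlonglongrightarrow> 2 * 0 * exp (c * max 0 T)"
          by (intro tendsto_intros \<epsilon>_lim)
        then have "\<forall>\<^sub>F N in sequentially. 2 * \<epsilon> N * exp (c * max 0 T) < e"
          using \<open>0 < e\<close> by (intro order_tendstoD(2)[where y = "2 * 0 * exp (c * max 0 T)"]) auto
        then show "\<forall>\<^sub>F N in sequentially. \<forall>t\<in>{..<T}. dist (W N i t) (w i t) < e"
        proof eventually_elim
          case (elim N)
          show ?case
          proof
            fix t assume "t \<in> {..<T}"
            then have "exp (c * max 0 t) \<le> exp (c * max 0 T)" using c by (auto intro: mult_left_mono)
            then have "2 * \<epsilon> N * exp (c * max 0 t) \<le> 2 * \<epsilon> N * exp (c * max 0 T)"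
              using \<epsilon>_nonneg by (intro mult_left_mono) auto
            then show "dist (W N i t) (w i t) < e"
              using w_diff[OF i, of N t] elim by (simp add: dist_real_def)
          qed
        qed
      qed
    qed auto
    then have "continuous_on (\<Union>T. {..<T}) (w i)"
      by (intro continuous_on_open_UN) auto
    moreover have "(\<Union>T. {..<T}) = (UNIV :: real set)" by (auto intro: gt_ex)
    ultimately show ?thesis by simp
  qed
  have eq: "w i t = x0 i + (LINT s:{0<..<t}|lebesgue. rate i (\<lambda>j. w j s))" if i: "1 \<le> i" and t: "0 \<le> t" for i t
  proof (rule LIMSEQ_unique[OF W_lim[OF i]])
    have "(\<lambda>N. LINT s:{0<..<t}|lebesgue. rate i (\<lambda>j. W N j s)) \<longlonglongrightarrow> (LINT s:{0<..<t}|lebesgue. rate i (\<lambda>j. w j s))"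
      unfolding set_lebesgue_integral_def
    proof (rule integral_dominated_convergence[where w = "\<lambda>s. indicator {0<..<t} s *\<^sub>R (A * K * K)"])
      show "integrable lebesgue (\<lambda>s. indicator {0<..<t} s *\<^sub>R (A * K * K))"
        using set_integrable_bounded_Ioo[of "\<lambda>_. A * K * K" t "\<bar>A * K * K\<bar>"] by (simp add: set_integrable_def)
      show "AE s in lebesgue. (\<lambda>N. indicator {0<..<t} s *\<^sub>R rate i (\<lambda>j. W N j s)) \<longlonglongrightarrow> indicator {0<..<t} s *\<^sub>R rate i (\<lambda>j. w j s)"
        by (intro AE_I2 tendsto_scaleR tendsto_const rate_lim[OF i])
      show "AE s in lebesgue. norm (indicator {0<..<t} s *\<^sub>R rate i (\<lambda>j. W N j s)) \<le> indicator {0<..<t} s *\<^sub>R (A * K * K)" for N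
        using abs_rate_le[OF i traj_adm[OF W]] by (intro AE_I2) (auto simp: indicator_def)
      show "(\<lambda>s. indicator {0<..<t} s *\<^sub>R rate i (\<lambda>j. W N j s)) \<in> borel_measurable lebesgue" for N
        using traj_rate_integrable[OF W i, of t N] unfolding set_integrable_def by (rule borel_measurable_integrable)
      have "(\<lambda>s. rate i (\<lambda>j. w j s)) \<in> borel_measurable lebesgue"
        by (rule borel_measurable_rate[OF i borel_measurable_lebesgue_continuous[OF cont_w] admissible_w])
      then show "(\<lambda>s. indicator {0<..<t} s *\<^sub>R rate i (\<lambda>j. w j s)) \<in> borel_measurable lebesgue"
        by (intro borel_measurable_scaleR borel_measurable_indicator) auto
    qed
    moreover have "(\<lambda>N. if i \<le> N then x0 i else 0) \<longlonglongrightarrow> x0 i"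
      by (rule tendsto_eventually) (auto simp: eventually_sequentially)
    ultimately have "(\<lambda>N. (if i \<le> N then x0 i else 0) + (LINT s:{0<..<t}|lebesgue. rate i (\<lambda>j. W N j s)))
        \<longlonglongrightarrow> x0 i + (LINT s:{0<..<t}|lebesgue. rate i (\<lambda>j. w j s))"
      by (rule tendsto_add[rotated])
    moreover have "W N i t = (if i \<le> N then x0 i else 0) + (LINT s:{0<..<t}|lebesgue. rate i (\<lambda>j. W N j s))" for N
      using W[of t N] i t unfolding traj_def by auto
    ultimately show "(\<lambda>N. W N i t) \<longlonglongrightarrow> x0 i + (LINT s:{0<..<t}|lebesgue. rate i (\<lambda>j. w j s))" by simp
  qed
  have "traj K T x0 w" for T
    unfolding traj_def using cont_w admissible_w eq by auto
  then show ?thesis by blast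
qed

subsection \<open>Trajectories and solutions\<close>

text \<open>\<open>gain\<close> is an iterated sum and the loss a single series, whereas
  \<open>rate\<close> is one unordered double sum. Domination by a summable product lets them be
  exchanged, and makes the convergence demanded of a solution hold at every time.\<close>

lemma
  assumes i: "1 \<le> i" and y: "admissible K y"
  shows gain_summable: "(\<lambda>(j, k). b i j k * a j k * y j * y k) summable_on {i+1..} \<times> {1..}"
    and gain_eq: "gain a b y i = (\<Sum>\<^sub>\<infinity>(j, k)\<in>{i+1..} \<times> {1..}. b i j k * a j k * y j * y k)"
    and gain_converges_admissible: "gain_converges a b y i"
    and abs_gain_le: "\<bar>gain a b y i\<bar> \<le> A * K * K"
    and loss_summable: "(\<lambda>j. a i j * y j) summable_on {1..}"
    and rate_eq_gain_diff: "rate i y = gain a b y i - (\<Sum>\<^sub>\<infinity>j\<in>{1..}. a i j * y i * y j)"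
    and abs_loss_le: "\<bar>\<Sum>\<^sub>\<infinity>j\<in>{1..}. a i j * y j\<bar> \<le> A * real i powr (1 + \<gamma>) * K"
proof -
  have "\<bar>case (j, k) of (j, k) \<Rightarrow> frag i j k * a j k * y j * y k\<bar> \<le> real j * a j k * y j * y k"
    if jk: "1 \<le> j" "1 \<le> k" for j k
    using mult_right_mono[OF frag_le[OF i jk(2), of j], of "a j k * y j * y k"] frag_nonneg[OF i jk(2), of j]
      a_nonneg[OF jk] admissible_nonneg[OF y] jk by (simp add: mult_ac)
  note fr = bilinear_dominated[OF y y this]
  have cong: "(\<Sum>\<^sub>\<infinity>(j, k)\<in>{i+1..} \<times> {1..}. b i j k * a j k * y j * y k) = (\<Sum>\<^sub>\<infinity>(j, k)\<in>{1..} \<times> {1..}. frag i j k * a j k * y j * y k)"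
    by (rule infsum_cong_neutral) (auto simp: frag_def split: if_splits)
  show s: "(\<lambda>(j, k). b i j k * a j k * y j * y k) summable_on {i+1..} \<times> {1..}"
    using fr(1) by (rule summable_on_cong_neutral[THEN iffD1, rotated -1]) (auto simp: frag_def split: if_splits)
  show g: "gain a b y i = (\<Sum>\<^sub>\<infinity>(j, k)\<in>{i+1..} \<times> {1..}. b i j k * a j k * y j * y k)"
    unfolding gain_def by (rule infsum_Sigma'_banach[OF s])
  show "gain_converges a b y i"
    unfolding gain_converges_def
    using summable_on_SigmaD1[OF s] summable_on_Sigma_banach[OF s] by auto
  have "\<bar>gain a b y i\<bar> \<le> A * mom y * mass y" unfolding g cong using fr(2) by simp
  also have "\<dots> \<le> A * K * K"
    using A_pos mom_le[OF y] mass_le[OF y] mom_nonneg[OF y] mass_nonneg[OF y]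
    by (intro mult_mono) auto
  finally show "\<bar>gain a b y i\<bar> \<le> A * K * K" .
  have dom: "\<bar>a i j * y j\<bar> \<le> A * real i powr (1 + \<gamma>) * (real j * y j)" if j: "j \<in> {1..}" for j
  proof -
    have "1 * a i j \<le> real i * a i j" using i j a_nonneg[of i j] by (intro mult_right_mono) auto
    also have "\<dots> \<le> A * (real i powr (1 + \<gamma>) * real j)" using mult_a_le[of i j] i j by simp
    finally have "a i j * y j \<le> A * (real i powr (1 + \<gamma>) * real j) * y j"
      using admissible_nonneg[OF y, of j] j by (intro mult_right_mono) auto
    then show ?thesis using a_nonneg[of i j] admissible_nonneg[OF y, of j] i j by (simp add: mult_ac)
  qed
  have dom_sum: "((\<lambda>j. A * real i powr (1 + \<gamma>) * (real j * y j)) has_sum (A * real i powr (1 + \<gamma>) * mass y)) {1..}"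
    unfolding mass_def by (intro has_sum_cmult_right has_sum_infsum admissible_summable1[OF y])
  show l: "(\<lambda>j. a i j * y j) summable_on {1..}"
    by (rule summable_on_norm_le(1)[OF has_sum_imp_summable[OF dom_sum] dom])
  have "\<bar>\<Sum>\<^sub>\<infinity>j\<in>{1..}. a i j * y j\<bar> \<le> A * real i powr (1 + \<gamma>) * mass y"
    using summable_on_norm_le(2)[OF has_sum_imp_summable[OF dom_sum] dom] infsumI[OF dom_sum] by simp
  also have "\<dots> \<le> A * real i powr (1 + \<gamma>) * K"
    using A_pos mass_le[OF y] by (intro mult_left_mono) auto
  finally show "\<bar>\<Sum>\<^sub>\<infinity>j\<in>{1..}. a i j * y j\<bar> \<le> A * real i powr (1 + \<gamma>) * K" .
  have "((\<lambda>k. y i * (a i k * y k)) has_sum (y i * (\<Sum>\<^sub>\<infinity>k\<in>{1..}. a i k * y k))) {1..}"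
    by (intro has_sum_cmult_right has_sum_infsum l)
  then have l2: "((\<lambda>k. a i k * y i * y k) has_sum (\<Sum>\<^sub>\<infinity>k\<in>{1..}. a i k * y i * y k)) {1..}"
    by (simp add: mult_ac has_sum_imp_summable has_sum_infsum)
  \<comment> \<open>The single series of the loss is placed on the row j = i of the double index set
    and then extended by zero.\<close>
  have "((\<lambda>(j, k). a j k * y j * y k) has_sum (\<Sum>\<^sub>\<infinity>k\<in>{1..}. a i k * y i * y k)) (Pair i ` {1..})"
    by (subst has_sum_reindex) (use l2 in \<open>auto simp: inj_on_def o_def\<close>)
  then have "((\<lambda>(j, k). if j = i then a j k * y j * y k else 0) has_sum (\<Sum>\<^sub>\<infinity>k\<in>{1..}. a i k * y i * y k)) ({1..} \<times> {1..})"
    by (rule has_sum_cong_neutral[THEN iffD1, rotated -1]) (use i in auto)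
  from has_sum_add[OF has_sum_infsum[OF fr(1)] has_sum_uminusI[OF this]]
  have "((\<lambda>(j, k). coef i j k * y j * y k) has_sum
     ((\<Sum>\<^sub>\<infinity>(j, k)\<in>{1..} \<times> {1..}. frag i j k * a j k * y j * y k) + - (\<Sum>\<^sub>\<infinity>k\<in>{1..}. a i k * y i * y k))) ({1..} \<times> {1..})"
    by (rule has_sum_cong[THEN iffD1, rotated]) (auto simp: coef_def algebra_simps)
  then show "rate i y = gain a b y i - (\<Sum>\<^sub>\<infinity>j\<in>{1..}. a i j * y i * y j)"
    unfolding rate_def g cong by (simp add: infsumI)
qed

lemma borel_measurable_gain:
  assumes i: "1 \<le> i" and w: "\<And>i. 1 \<le> i \<Longrightarrow> w i \<in> borel_measurable M" and admissible: "\<And>s. admissible K (\<lambda>i. w i s)"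
  shows "(\<lambda>s. gain a b (\<lambda>j. w j s) i) \<in> borel_measurable M"
  unfolding gain_eq[OF i admissible]
proof (rule borel_measurable_infsum)
  fix jk :: "nat \<times> nat" assume "jk \<in> {i+1..} \<times> {1..}"
  then show "(\<lambda>s. case jk of (j, k) \<Rightarrow> b i j k * a j k * w j s * w k s) \<in> borel_measurable M"
    using i by (auto intro!: borel_measurable_times w)
qed (use gain_summable[OF i admissible] in auto)

lemma traj_is_solution:
  assumes w: "\<And>T. traj K T w0 w" and w0: "w0 \<in> Y_pos 1"
  shows "is_solution a b \<infinity> w0 w"
  unfolding is_solution_def
proof (intro conjI allI impI w0)
  fix i :: nat assume i: "1 \<le> i"
  have admissible: "admissible K (\<lambda>i. w i t)" for t by (rule traj_adm[OF w])
  show "0 \<le> w i t" for t using admissible_nonneg[OF admissible i] .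
  show "continuous_on {t. 0 \<le> t \<and> ereal t < \<infinity>} (w i)"
    using w i unfolding traj_def by (blast intro: continuous_on_subset)
  fix t :: real assume t: "0 < t \<and> ereal t < \<infinity>"
  show "AE \<tau> in lebesgue. \<tau> \<in> {0<..<t} \<longrightarrow> (\<lambda>j. a i j * w j \<tau>) summable_on {1..}"
    using loss_summable[OF i admissible] by simp
  have "(\<lambda>\<tau>. \<Sum>\<^sub>\<infinity>j\<in>{1..}. a i j * w j \<tau>) \<in> borel_measurable lebesgue"
    by (rule borel_measurable_infsum)
       (use loss_summable[OF i admissible] traj_measurable[OF w] in \<open>auto intro!: borel_measurable_times\<close>)
  then show "set_integrable lebesgue {0<..<t} (\<lambda>\<tau>. \<Sum>\<^sub>\<infinity>j\<in>{1..}. a i j * w j \<tau>)"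
    by (rule set_integrable_bounded_Ioo[OF _ abs_loss_le[OF i admissible]])
  show "AE \<tau> in lebesgue. \<tau> \<in> {0<..<t} \<longrightarrow> gain_converges a b (\<lambda>l. w l \<tau>) i"
    using gain_converges_admissible[OF i admissible] by simp
  show "set_integrable lebesgue {0<..<t} (\<lambda>\<tau>. gain a b (\<lambda>l. w l \<tau>) i)"
    by (rule set_integrable_bounded_Ioo[OF borel_measurable_gain[OF i traj_measurable[OF w] admissible] abs_gain_le[OF i admissible]])
  have "w i t = w0 i + (LINT s:{0<..<t}|lebesgue. rate i (\<lambda>j. w j s))"
    using w[of t] i t unfolding traj_def by auto
  then show "w i t = w0 i + (LINT \<tau>:{0<..<t}|lebesgue.
          gain a b (\<lambda>l. w l \<tau>) i - (\<Sum>\<^sub>\<infinity>j\<in>{1..}. a i j * w i \<tau> * w j \<tau>))"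
    by (simp only: rate_eq_gain_diff[OF i admissible])
qed simp

lemma traj_moment_locally_bounded:
  assumes "\<And>T. traj K T w0 w"
  shows "moment_locally_bounded (1 + \<gamma>) w"
  unfolding moment_locally_bounded_def
  using admissible_summable[OF traj_adm[OF assms]] mom_le[OF traj_adm[OF assms]]
  by (auto simp: mom_def intro!: bdd_aboveI2[where M=K])

text \<open>Clamping time to [0, T] turns the locally bounded moment into one constant K valid at
  all real times, and continuity on the half-line into continuity on the whole line.\<close>

lemma solution_traj:
  assumes sol: "is_solution a b \<infinity> w0 v" and bd: "moment_locally_bounded (1 + \<gamma>) v" and T: "0 < T"
  shows "\<exists>K. traj K T w0 (\<lambda>i t. v i (min T (max 0 t)))"
proof -
  let ?v = "\<lambda>i t. v i (min T (max 0 t))"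
  have nonneg: "0 \<le> v i t" if "1 \<le> i" "0 \<le> t" for i t
    using sol that by (auto simp: is_solution_def)
  have cont: "continuous_on {0..} (v i)" if "1 \<le> i" for i
  proof -
    have "{t. 0 \<le> t \<and> ereal t < \<infinity>} = {0..}" by auto
    then show ?thesis using sol that by (auto simp: is_solution_def)
  qed
  obtain K where K: "\<And>t. t \<in> {0..T} \<Longrightarrow> (\<Sum>\<^sub>\<infinity>i\<in>{1..}. real i powr (1 + \<gamma>) * v i t) \<le> K"
    using bd T unfolding moment_locally_bounded_def bdd_above_def by (meson image_eqI)
  have admissible: "admissible K (\<lambda>i. ?v i t)" for t
    unfolding admissible_def
  proof (intro conjI allI impI)
    have mem: "min T (max 0 t) \<in> {0..T}" using T by auto
    then show nn: "0 \<le> ?v i t" if "1 \<le> i" for i using nonneg[OF that] by simp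
    fix n
    have "(\<lambda>i. real i powr (1 + \<gamma>) * ?v i t) summable_on {1..}"
      using bd T mem unfolding moment_locally_bounded_def by blast
    then have "(\<Sum>i=1..n. real i powr (1 + \<gamma>) * ?v i t) \<le> (\<Sum>\<^sub>\<infinity>i\<in>{1..}. real i powr (1 + \<gamma>) * ?v i t)"
      by (rule sum_le_infsum_atLeast1) (use nn in auto)
    also have "\<dots> \<le> K" by (rule K[OF mem])
    finally show "(\<Sum>i=1..n. real i powr (1 + \<gamma>) * ?v i t) \<le> K" .
  qed
  have cont_v: "continuous_on UNIV (?v i)" if "1 \<le> i" for i
    by (rule continuous_on_compose2[OF cont[OF that]]) (use T in \<open>auto intro!: continuous_intros\<close>)
  have eq: "v i t = w0 i + (LINT s:{0<..<t}|lebesgue. rate i (\<lambda>j. ?v j s))" if i: "1 \<le> i" and t: "0 < t" "t \<le> T" for i t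
  proof -
    have "v i t = w0 i + (LINT \<tau>:{0<..<t}|lebesgue.
          gain a b (\<lambda>l. v l \<tau>) i - (\<Sum>\<^sub>\<infinity>j\<in>{1..}. a i j * v i \<tau> * v j \<tau>))"
      using sol i t by (auto simp: is_solution_def)
    also have "(LINT \<tau>:{0<..<t}|lebesgue. gain a b (\<lambda>l. v l \<tau>) i - (\<Sum>\<^sub>\<infinity>j\<in>{1..}. a i j * v i \<tau> * v j \<tau>))
        = (LINT \<tau>:{0<..<t}|lebesgue. rate i (\<lambda>j. ?v j \<tau>))"
    proof (rule set_lebesgue_integral_cong)
      show "\<forall>\<tau>. \<tau> \<in> {0<..<t} \<longrightarrow> gain a b (\<lambda>l. v l \<tau>) i - (\<Sum>\<^sub>\<infinity>j\<in>{1..}. a i j * v i \<tau> * v j \<tau>) = rate i (\<lambda>j. ?v j \<tau>)"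
      proof (intro allI impI)
        fix \<tau> assume "\<tau> \<in> {0<..<t}"
        then have "min T (max 0 \<tau>) = \<tau>" using t by auto
        then show "gain a b (\<lambda>l. v l \<tau>) i - (\<Sum>\<^sub>\<infinity>j\<in>{1..}. a i j * v i \<tau> * v j \<tau>) = rate i (\<lambda>j. ?v j \<tau>)"
          using rate_eq_gain_diff[OF i admissible[of \<tau>]] by simp
      qed
    qed simp
    finally show ?thesis .
  qed
  have meas: "(\<lambda>s. rate i (\<lambda>j. ?v j s)) \<in> borel_measurable lebesgue" if "1 \<le> i" for i
    by (rule borel_measurable_rate[OF that borel_measurable_lebesgue_continuous[OF cont_v] admissible])
  \<comment> \<open>The notion of solution imposes the integral equation for positive times only.
    The value at 0 is recovered from continuity and the estimate |v_i(t) - w0_i| \<le> A K K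
    t.\<close>
  have eq0: "v i 0 = w0 i" if i: "1 \<le> i" for i
  proof -
    have "\<forall>\<^sub>F t in at_right 0. \<bar>v i t - w0 i\<bar> \<le> A * K * K * t"
      unfolding eventually_at_right_field
    proof (intro exI[of _ T] conjI T allI impI)
      fix t assume t: "0 < t" "t < T"
      have "\<bar>v i t - w0 i\<bar> = \<bar>LINT s:{0<..<t}|lebesgue. rate i (\<lambda>j. ?v j s)\<bar>"
        using eq[OF i, of t] t by simp
      also have "\<dots> \<le> (LINT s:{0<..<t}|lebesgue. A * K * K)"
      proof (rule abs_set_integral_le)
        show "set_integrable lebesgue {0<..<t} (\<lambda>s. rate i (\<lambda>j. ?v j s))"
          by (rule set_integrable_bounded_Ioo[OF meas[OF i] abs_rate_le[OF i admissible]])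
        show "set_integrable lebesgue {0<..<t} (\<lambda>s. A * K * K)"
          by (rule set_integrable_bounded_Ioo[where B = "\<bar>A * K * K\<bar>"]) auto
        show "\<bar>rate i (\<lambda>j. ?v j s)\<bar> \<le> A * K * K" for s by (rule abs_rate_le[OF i admissible])
      qed
      also have "\<dots> = A * K * K * t"
        using t by (simp add: set_lebesgue_integral_def mult.commute)
      finally show "\<bar>v i t - w0 i\<bar> \<le> A * K * K * t" .
    qed
    then have ev: "\<forall>\<^sub>F t in at_right 0. norm (v i t - w0 i) \<le> A * K * K * t" by simp
    have "((\<lambda>t. A * K * K * t) \<longlongrightarrow> A * K * K * 0) (at_right 0)"
      by (rule tendsto_mult[OF tendsto_const tendsto_ident_at])
    then have "((\<lambda>t. A * K * K * t) \<longlongrightarrow> 0) (at_right 0)" by simp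
    with ev have "((\<lambda>t. v i t - w0 i) \<longlongrightarrow> 0) (at_right 0)" by (rule Lim_null_comparison)
    then have lim: "(v i \<longlongrightarrow> w0 i) (at_right 0)" by (rule Lim_null[THEN iffD2])
    have "(v i \<longlongrightarrow> v i 0) (at 0 within {0..})"
      using cont[OF i] by (simp add: continuous_on_def)
    then have "(v i \<longlongrightarrow> v i 0) (at_right 0)"
      by (rule tendsto_within_subset) auto
    from tendsto_unique[OF _ this lim] show ?thesis by simp
  qed
  have "traj K T w0 ?v"
    unfolding traj_def
  proof (intro conjI allI impI ballI cont_v admissible)
    fix i :: nat and t :: real assume i: "1 \<le> i" and t: "t \<in> {0..T}"
    show "?v i t = w0 i + (LINT s:{0<..<t}|lebesgue. rate i (\<lambda>j. ?v j s))"
    proof (cases "t = 0")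
      case True
      then show ?thesis using eq0[OF i] T by (simp add: set_lebesgue_integral_def)
    next
      case False
      then have t': "0 < t" "t \<le> T" and clamp: "min T (max 0 t) = t" using t by auto
      show ?thesis unfolding clamp by (rule eq[OF i t'])
    qed
  qed
  then show ?thesis by blast
qed

section \<open>Uniqueness\<close>

lemma traj_mono: "traj K T w0 w \<Longrightarrow> K \<le> K' \<Longrightarrow> traj K' T w0 w"
  by (auto simp: traj_def admissible_def intro: order_trans[of _ K K'])

text \<open>This is stability with D0 = 0, once both trajectories are given the common moment bound
  \<open>max K K'\<close>.\<close>

lemma traj_unique:
  assumes w: "traj K T w0 w" and v: "traj K' T w0 v" and t: "0 \<le> t" "t \<le> T" and i: "1 \<le> i"
  shows "w i t = v i t"
proof -
  define u where "u i = \<bar>w i t - v i t\<bar>" for i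
  have u: "admissible (K + K') u" unfolding u_def[abs_def] by (rule admissible_abs_diff[OF traj_adm[OF w] traj_adm[OF v]])
  have "mass u \<le> 2 * 0 * exp (2 * (2 * A * max K K' + 1) * t)"
    unfolding u_def[abs_def]
    by (rule traj_stability[OF traj_mono[OF w] traj_mono[OF v] _ t]) auto
  moreover have "(\<Sum>i=1..i. real i * u i) \<le> mass u" unfolding mass_def
    by (rule sum_le_infsum_atLeast1[OF admissible_summable1[OF u]]) (use admissible_nonneg[OF u] in auto)
  moreover have "real i * u i \<le> (\<Sum>i=1..i. real i * u i)"
    by (rule member_le_sum) (use i admissible_nonneg[OF u] in auto)
  ultimately have "real i * u i \<le> 0" by simp
  then show ?thesis using i by (simp add: u_def mult_le_0_iff)
qed

end

theorem corollary3p1: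
  fixes a :: "nat \<Rightarrow> nat \<Rightarrow> real"
    and b :: "nat \<Rightarrow> nat \<Rightarrow> nat \<Rightarrow> real"
    and \<gamma> A \<beta>\<^sub>0 \<beta>\<^sub>1 :: real
    and w_in :: "nat \<Rightarrow> real"
  assumes a_sym: "\<And>i j. i \<ge> 1 \<Longrightarrow> j \<ge> 1 \<Longrightarrow> a i j = a j i"
    and a_nonneg: "\<And>i j. i \<ge> 1 \<Longrightarrow> j \<ge> 1 \<Longrightarrow> 0 \<le> a i j"
    and gamma: "0 \<le> \<gamma>" "\<gamma> \<le> 1"
    and A_pos: "0 < A"
    and a_bound: "\<And>i j. i \<ge> 1 \<Longrightarrow> j \<ge> 1 \<Longrightarrow> a i j \<le> A * (real i * real j) powr \<gamma>"
    and b_nonneg: "\<And>i j k. 1 \<le> i \<Longrightarrow> i \<le> j - 1 \<Longrightarrow> j \<ge> 2 \<Longrightarrow> k \<ge> 1 \<Longrightarrow> 0 \<le> b i j k"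
    and b_mass: "\<And>j k. j \<ge> 2 \<Longrightarrow> k \<ge> 1 \<Longrightarrow> (\<Sum>i=1..j-1. real i * b i j k) = real j"
    and beta: "0 \<le> \<beta>\<^sub>0" "0 \<le> \<beta>\<^sub>1"
    and b_bound: "\<And>s i j. 1 \<le> s \<Longrightarrow> s \<le> i - 1 \<Longrightarrow> j \<ge> i \<Longrightarrow> b s i j \<le> \<beta>\<^sub>0 + \<beta>\<^sub>1 * b s j i"
    and w_in: "w_in \<in> Y_pos (1 + \<gamma>)"
  shows "\<exists>w. is_solution a b \<infinity> w_in w \<and> moment_locally_bounded (1 + \<gamma>) w \<and>
    (\<forall>v. is_solution a b \<infinity> w_in v \<and> moment_locally_bounded (1 + \<gamma>) v \<longrightarrow>
      (\<forall>i\<ge>1. \<forall>t\<ge>0. v i t = w i t))"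
proof -
  interpret collision_kernel a b \<gamma> A
    by unfold_locales fact+
  define K where "K = (\<Sum>\<^sub>\<infinity>i\<in>{1..}. real i powr (1 + \<gamma>) * \<bar>w_in i\<bar>)"
  have abs: "\<bar>w_in i\<bar> = w_in i" if "1 \<le> i" for i using w_in that by (simp add: Y_pos_def)
  have admissible: "admissible K w_in"
    unfolding admissible_def
  proof (intro conjI allI impI)
    show "0 \<le> w_in i" if "1 \<le> i" for i using w_in that by (simp add: Y_pos_def)
    fix n
    have "(\<Sum>i=1..n. real i powr (1 + \<gamma>) * w_in i) = (\<Sum>i=1..n. real i powr (1 + \<gamma>) * \<bar>w_in i\<bar>)"
      by (intro sum.cong) (auto simp: abs)
    also have "\<dots> \<le> K"
      unfolding K_def by (rule sum_le_infsum_atLeast1) (use w_in in \<open>auto simp: Y_pos_def Y_def\<close>)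
    finally show "(\<Sum>i=1..n. real i powr (1 + \<gamma>) * w_in i) \<le> K" .
  qed
  \<comment> \<open>The notion of solution itself demands initial data in
    \<open>Y_pos 1\<close>.\<close>
  have "(\<lambda>i. real i powr 1 * \<bar>w_in i\<bar>) summable_on {1..}"
    using admissible_summable1[OF admissible] by (rule summable_on_cong[THEN iffD1, rotated]) (auto simp: abs)
  then have Y1: "w_in \<in> Y_pos 1" using w_in by (simp add: Y_pos_def Y_def)
  obtain w where w: "\<And>T. traj K T w_in w" using ex_traj[OF admissible] by blast
  have "v i t = w i t"
    if sol: "is_solution a b \<infinity> w_in v" "moment_locally_bounded (1 + \<gamma>) v" and i: "1 \<le> i" and t: "0 \<le> t" for v i t
  proof -
    \<comment> \<open>The horizon t + 1 is positive even for t = 0, and the clamping does not affect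
      time t.\<close>
    obtain K' where "traj K' (t + 1) w_in (\<lambda>i s. v i (min (t + 1) (max 0 s)))"
      using solution_traj[OF sol, of "t + 1"] t by auto
    from traj_unique[OF w this t _ i] show ?thesis using t by (simp add: min_def max_def)
  qed
  then show ?thesis using traj_is_solution[OF w Y1] traj_moment_locally_bounded[OF w] by blast
qed

end
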